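(* Let $\phi$ and $\psi$ be hyperbolic Möbius transformations of $\mathbb{U}$, with attracting fixed points $\varsigma_1$ and $\zeta_1$ and repelling fixed points $\varsigma_2$ and $\zeta_2$, respectively. Let $w\in\mathbb{A}^2$ and let $$(Tf)(z_1,z_2)=w(z_1,z_2)f(\phi(z_1),\psi(z_2)),\qquad f\in\mathbb{A}^2,\ (z_1,z_2)\in\mathbb{D}^2.$$ Assume that $w$ is invertible in $\mathbb{A}^2$ and that $$r=|w(\varsigma_1,\zeta_1)|<|w(\varsigma_1,\zeta_2)|<|w(\varsigma_2,\zeta_1)|<|w(\varsigma_2,\zeta_2)|=R.$$ Then $$\sigma_{lsf}(T)=\sigma(T)=\mathbb{AN}(r,R),$$ $$\sigma_{usf}(T)=r\mathbb{T}\cup|w(\varsigma_1,\zeta_2)|\mathbb{T}\cup|w(\varsigma_2,\zeta_1)|\mathbb{T}\cup R\mathbb{T}.$$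
   Context: $\mathbb{D}$, $\mathbb{U}$ and $\mathbb{T}$ are the closed unit disc, the open unit disc and the unit circle in $\mathbb{C}$. For $c\in\mathbb{C}$ and $S\subseteq\mathbb{C}$, $cS=\{cs:s\in S\}$. $\mathbb{AN}(r,R)=\{\lambda\in\mathbb{C}:r\le|\lambda|\le R\}$. A Möbius transformation of $\mathbb{U}$ is a conformal automorphism of $\mathbb{U}$, extended to $\mathbb{D}$; it is hyperbolic if it has exactly two fixed points in $\mathbb{D}$, both on $\mathbb{T}$ (one attracting, with derivative of modulus $<1$, and one repelling). $\mathbb{A}^2$ is the bidisc algebra: all functions continuous on $\mathbb{D}^2$ and analytic in $\mathbb{U}^2$, with the sup norm. For a bounded linear operator $T$ on a Banach space: $T$ is upper semi-Fredholm if its range is closed and $\dim\ker T<\infty$; lower semi-Fredholm if its range has finite codimension. $\sigma(T)$ is the spectrum; $\sigma_{usf}(T)$ and $\sigma_{lsf}(T)$ are the sets of $\lambda\in\mathbb{C}$ such that $\lambda I-T$ is not upper semi-Fredholm, respectively not lower semi-Fredholm. *)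

theory Defs
  imports "HOL-Complex_Analysis.Complex_Analysis"
begin

section \<open>Operators on complex Banach spaces\<close>

text \<open>Complex Banach spaces: Banach spaces in the sense of the library (over the reals) with
  a compatible complex scalar multiplication.\<close>

class complex_banach = banach +
  fixes cscale :: "complex \<Rightarrow> 'a \<Rightarrow> 'a"  (infixr "*\<^sub>C" 75)
  assumes cscale_right_distrib: "a *\<^sub>C (x + y) = a *\<^sub>C x + a *\<^sub>C y"
    and cscale_left_distrib: "(a + b) *\<^sub>C x = a *\<^sub>C x + b *\<^sub>C x"
    and cscale_cscale: "a *\<^sub>C (b *\<^sub>C x) = (a * b) *\<^sub>C x"
    and cscale_one: "1 *\<^sub>C x = x"
    and cscale_of_real: "complex_of_real r *\<^sub>C x = r *\<^sub>R x"
    and norm_cscale: "norm (a *\<^sub>C x) = norm a * norm x"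

global_interpretation cvec: vector_space "cscale :: complex \<Rightarrow> 'a \<Rightarrow> 'a::complex_banach"
  by unfold_locales
    (simp_all add: cscale_right_distrib cscale_left_distrib cscale_cscale cscale_one)

definition bounded_clinear :: "('a::complex_banach \<Rightarrow> 'b::complex_banach) \<Rightarrow> bool" where
  "bounded_clinear T \<longleftrightarrow> bounded_linear T \<and> (\<forall>c x. T (c *\<^sub>C x) = c *\<^sub>C T x)"

definition op_invertible :: "('a::complex_banach \<Rightarrow> 'a) \<Rightarrow> bool" where
  "op_invertible T \<longleftrightarrow>
     bounded_clinear T \<and> (\<exists>S. bounded_clinear S \<and> S \<circ> T = id \<and> T \<circ> S = id)"

definition upper_semi_fredholm :: "('a::complex_banach \<Rightarrow> 'a) \<Rightarrow> bool" where
  "upper_semi_fredholm T \<longleftrightarrow> bounded_clinear T \<and> closed (range T) \<and>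
     (\<exists>B. finite B \<and> {x. T x = 0} \<subseteq> cvec.span B)"

definition lower_semi_fredholm :: "('a::complex_banach \<Rightarrow> 'a) \<Rightarrow> bool" where
  "lower_semi_fredholm T \<longleftrightarrow> bounded_clinear T \<and>
     (\<exists>B. finite B \<and> {y + b | y b. y \<in> range T \<and> b \<in> cvec.span B} = UNIV)"

definition op_spectrum :: "('a::complex_banach \<Rightarrow> 'a) \<Rightarrow> complex set" where
  "op_spectrum T = {l. \<not> op_invertible (\<lambda>x. l *\<^sub>C x - T x)}"

definition usf_spectrum :: "('a::complex_banach \<Rightarrow> 'a) \<Rightarrow> complex set" where
  "usf_spectrum T = {l. \<not> upper_semi_fredholm (\<lambda>x. l *\<^sub>C x - T x)}"

definition lsf_spectrum :: "('a::complex_banach \<Rightarrow> 'a) \<Rightarrow> complex set" where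
  "lsf_spectrum T = {l. \<not> lower_semi_fredholm (\<lambda>x. l *\<^sub>C x - T x)}"


section \<open>The bidisc algebra\<close>

abbreviation bidisc :: "(complex \<times> complex) set" where
  "bidisc \<equiv> cball 0 1 \<times> cball 0 1"

text \<open>A function of two complex variables is analytic on the open bidisc if it is continuous
  there and holomorphic in each variable separately; continuity is part of
  \<open>bidisc_alg_set\<close>.\<close>

definition sep_holomorphic :: "(complex \<times> complex \<Rightarrow> complex) \<Rightarrow> bool" where
  "sep_holomorphic f \<longleftrightarrow>
     (\<forall>b\<in>ball 0 1. (\<lambda>z. f (z, b)) holomorphic_on ball 0 1) \<and>
     (\<forall>a\<in>ball 0 1. (\<lambda>z. f (a, z)) holomorphic_on ball 0 1)"

text \<open>Functions on the closed bidisc are represented by their extension by \<open>0\<close>, so that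
  equality is equality on the closed bidisc.\<close>

definition bidisc_alg_set :: "(complex \<times> complex \<Rightarrow> complex) set" where
  "bidisc_alg_set = {f. continuous_on bidisc f \<and> sep_holomorphic f \<and> (\<forall>p. p \<notin> bidisc \<longrightarrow> f p = 0)}"

lemma bidisc_alg_setI:
  assumes "continuous_on bidisc g"
    and "\<And>b. norm b < 1 \<Longrightarrow> (\<lambda>z. g (z, b)) holomorphic_on ball 0 1"
    and "\<And>a. norm a < 1 \<Longrightarrow> (\<lambda>z. g (a, z)) holomorphic_on ball 0 1"
    and "\<And>p. p \<in> bidisc \<Longrightarrow> f p = g p" and "\<And>p. p \<notin> bidisc \<Longrightarrow> f p = 0"
  shows "f \<in> bidisc_alg_set"
proof -
  have "continuous_on bidisc f"
    using assms(1,4) by (metis (no_types, lifting) continuous_on_cong)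
  moreover have "(\<lambda>z. f (z, b)) holomorphic_on ball 0 1" if "norm b < 1" for b
    using assms(2)[OF that] by (rule holomorphic_transform) (use that assms(4) in auto)
  moreover have "(\<lambda>z. f (a, z)) holomorphic_on ball 0 1" if "norm a < 1" for a
    using assms(3)[OF that] by (rule holomorphic_transform) (use that assms(4) in auto)
  ultimately show ?thesis
    using assms(5) by (simp add: bidisc_alg_set_def sep_holomorphic_def)
qed

typedef bidisc_algebra = bidisc_alg_set
  morphisms ev Abs_bidisc_algebra
proof
  show "(\<lambda>_. 0) \<in> bidisc_alg_set"
    by (rule bidisc_alg_setI[where g = "\<lambda>_. 0"]) auto
qed

setup_lifting type_definition_bidisc_algebra

lemma bidisc_alg_setD:
  assumes "f \<in> bidisc_alg_set"
  shows "continuous_on bidisc f"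
    and "norm b < 1 \<Longrightarrow> (\<lambda>z. f (z, b)) holomorphic_on ball 0 1"
    and "norm a < 1 \<Longrightarrow> (\<lambda>z. f (a, z)) holomorphic_on ball 0 1"
    and "p \<notin> bidisc \<Longrightarrow> f p = 0"
  using assms unfolding bidisc_alg_set_def sep_holomorphic_def by (blast | simp)+

lemma ev_outside: "p \<notin> bidisc \<Longrightarrow> ev f p = 0"
  by (rule bidisc_alg_setD(4)[OF ev])

lemma bidisc_algebra_eqI:
  assumes "\<And>p. p \<in> bidisc \<Longrightarrow> ev f p = ev g p"
  shows "f = g"
  by (metis assms ev_inject ev_outside ext)

lemma compact_bidisc: "compact bidisc"
  by (intro compact_Times compact_cball)

lemma bdd_above_ev: "bdd_above ((\<lambda>p. norm (ev f p)) ` bidisc)"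
proof -
  have "compact ((\<lambda>p. norm (ev f p)) ` bidisc)"
    by (intro compact_continuous_image continuous_intros bidisc_alg_setD(1)[OF ev] compact_bidisc)
  then show ?thesis
    by (intro bounded_imp_bdd_above compact_imp_bounded)
qed

instantiation bidisc_algebra :: comm_ring_1
begin

lift_definition zero_bidisc_algebra :: bidisc_algebra is "\<lambda>_. 0"
  by (rule bidisc_alg_setI[where g = "\<lambda>_. 0"]) auto

lift_definition one_bidisc_algebra :: bidisc_algebra is "\<lambda>p. if p \<in> bidisc then 1 else 0"
  by (rule bidisc_alg_setI[where g = "\<lambda>_. 1"]) auto

lift_definition plus_bidisc_algebra :: "bidisc_algebra \<Rightarrow> bidisc_algebra \<Rightarrow> bidisc_algebra"
  is "\<lambda>f g p. f p + g p"
  subgoal for f g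
    by (rule bidisc_alg_setI[where g = "\<lambda>p. f p + g p"])
       (auto intro!: continuous_intros holomorphic_intros simp: bidisc_alg_setD simp del: mem_Times_iff)
  done

lift_definition uminus_bidisc_algebra :: "bidisc_algebra \<Rightarrow> bidisc_algebra" is "\<lambda>f p. - f p"
  subgoal for f
    by (rule bidisc_alg_setI[where g = "\<lambda>p. - f p"])
       (auto intro!: continuous_intros holomorphic_intros simp: bidisc_alg_setD simp del: mem_Times_iff)
  done

lift_definition minus_bidisc_algebra :: "bidisc_algebra \<Rightarrow> bidisc_algebra \<Rightarrow> bidisc_algebra"
  is "\<lambda>f g p. f p - g p"
  subgoal for f g
    by (rule bidisc_alg_setI[where g = "\<lambda>p. f p - g p"])
       (auto intro!: continuous_intros holomorphic_intros simp: bidisc_alg_setD simp del: mem_Times_iff)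
  done

lift_definition times_bidisc_algebra :: "bidisc_algebra \<Rightarrow> bidisc_algebra \<Rightarrow> bidisc_algebra"
  is "\<lambda>f g p. f p * g p"
  subgoal for f g
    by (rule bidisc_alg_setI[where g = "\<lambda>p. f p * g p"])
       (auto intro!: continuous_intros holomorphic_intros simp: bidisc_alg_setD simp del: mem_Times_iff)
  done

instance
proof
  show "1 * a = a" for a :: bidisc_algebra
    by transfer (auto simp: bidisc_alg_set_def)
  show "(0::bidisc_algebra) \<noteq> 1"
    by transfer (auto dest!: fun_cong[where x = "(0, 0)"])
qed (transfer; simp add: algebra_simps fun_eq_iff)+

end

lift_definition bidisc_scale :: "complex \<Rightarrow> bidisc_algebra \<Rightarrow> bidisc_algebra"
  is "\<lambda>c f p. c * f p"
  subgoal for c f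
    by (rule bidisc_alg_setI[where g = "\<lambda>p. c * f p"])
       (auto intro!: continuous_intros holomorphic_intros simp: bidisc_alg_setD simp del: mem_Times_iff)
  done

lemmas ev_simps [simp] = zero_bidisc_algebra.rep_eq plus_bidisc_algebra.rep_eq
  minus_bidisc_algebra.rep_eq uminus_bidisc_algebra.rep_eq times_bidisc_algebra.rep_eq
  bidisc_scale.rep_eq

instantiation bidisc_algebra :: real_normed_vector
begin

definition scaleR_bidisc_algebra :: "real \<Rightarrow> bidisc_algebra \<Rightarrow> bidisc_algebra" where
  "scaleR_bidisc_algebra r f = bidisc_scale (complex_of_real r) f"

definition norm_bidisc_algebra :: "bidisc_algebra \<Rightarrow> real" where
  "norm_bidisc_algebra f = (SUP p\<in>bidisc. norm (ev f p))"

definition dist_bidisc_algebra :: "bidisc_algebra \<Rightarrow> bidisc_algebra \<Rightarrow> real" where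
  "dist_bidisc_algebra f g = norm (f - g)"

definition sgn_bidisc_algebra :: "bidisc_algebra \<Rightarrow> bidisc_algebra" where
  "sgn_bidisc_algebra f = inverse (norm f) *\<^sub>R f"

definition uniformity_bidisc_algebra :: "(bidisc_algebra \<times> bidisc_algebra) filter" where
  "uniformity_bidisc_algebra = (INF e\<in>{0<..}. principal {(x, y). dist x y < e})"

definition open_bidisc_algebra :: "bidisc_algebra set \<Rightarrow> bool" where
  "open_bidisc_algebra U \<longleftrightarrow> (\<forall>x\<in>U. \<forall>\<^sub>F (x', y) in uniformity. x' = x \<longrightarrow> y \<in> U)"

lemma norm_ev_le: "norm (ev f p) \<le> norm f"
proof (cases "p \<in> bidisc")
  case True
  then show ?thesis
    unfolding norm_bidisc_algebra_def by (intro cSUP_upper bdd_above_ev)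
next
  case False
  have "0 \<le> norm (ev f (0, 0))" by simp
  also have "\<dots> \<le> norm f"
    unfolding norm_bidisc_algebra_def by (intro cSUP_upper bdd_above_ev) auto
  finally show ?thesis by (simp add: ev_outside[OF False])
qed

lemma norm_bidisc_algebra_le:
  assumes "\<And>p. p \<in> bidisc \<Longrightarrow> norm (ev f p) \<le> C"
  shows "norm f \<le> C"
  unfolding norm_bidisc_algebra_def by (rule cSUP_least) (use assms in auto)

lemma norm_bidisc_scale: "norm (bidisc_scale c f) = norm c * norm f"
proof (rule antisym)
  show "norm (bidisc_scale c f) \<le> norm c * norm f"
    by (rule norm_bidisc_algebra_le) (simp add: norm_mult mult_left_mono norm_ev_le)
  show "norm c * norm f \<le> norm (bidisc_scale c f)"
  proof (cases "c = 0")
    case True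
    have "0 \<le> norm (ev (bidisc_scale c f) (0, 0))" by simp
    also have "\<dots> \<le> norm (bidisc_scale c f)" by (rule norm_ev_le)
    finally show ?thesis using True by simp
  next
    case False
    have "norm f \<le> norm (bidisc_scale c f) / norm c"
    proof (rule norm_bidisc_algebra_le)
      fix p
      show "norm (ev f p) \<le> norm (bidisc_scale c f) / norm c"
        using norm_ev_le[of "bidisc_scale c f" p] False
        by (simp add: norm_mult pos_le_divide_eq mult.commute)
    qed
    then show ?thesis using False by (simp add: pos_le_divide_eq mult.commute)
  qed
qed

instance
proof
  fix x y :: bidisc_algebra and r s :: real
  show "dist x y = norm (x - y)" by (simp add: dist_bidisc_algebra_def)
  show "sgn x = inverse (norm x) *\<^sub>R x" by (simp add: sgn_bidisc_algebra_def)
  show "uniformity = (INF e\<in>{0<..}. principal {(x :: bidisc_algebra, y). dist x y < e})"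
    by (simp add: uniformity_bidisc_algebra_def)
  show "open U \<longleftrightarrow> (\<forall>x\<in>U. \<forall>\<^sub>F (x', y) in uniformity. x' = x \<longrightarrow> y \<in> U)"
    for U :: "bidisc_algebra set"
    by (simp add: open_bidisc_algebra_def)
  show "r *\<^sub>R (x + y) = r *\<^sub>R x + r *\<^sub>R y"
    by (rule bidisc_algebra_eqI) (simp add: scaleR_bidisc_algebra_def algebra_simps)
  show "(r + s) *\<^sub>R x = r *\<^sub>R x + s *\<^sub>R x"
    by (rule bidisc_algebra_eqI) (simp add: scaleR_bidisc_algebra_def algebra_simps)
  show "r *\<^sub>R s *\<^sub>R x = (r * s) *\<^sub>R x"
    by (rule bidisc_algebra_eqI) (simp add: scaleR_bidisc_algebra_def algebra_simps)
  show "1 *\<^sub>R x = x"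
    by (rule bidisc_algebra_eqI) (simp add: scaleR_bidisc_algebra_def)
  show "norm (r *\<^sub>R x) = \<bar>r\<bar> * norm x"
    by (simp add: scaleR_bidisc_algebra_def norm_bidisc_scale)
  show "norm (x + y) \<le> norm x + norm y"
    by (rule norm_bidisc_algebra_le) (simp add: add_mono norm_ev_le norm_triangle_le)
  show "norm x = 0 \<longleftrightarrow> x = 0"
  proof
    assume "norm x = 0"
    then have "ev x p = 0" for p using norm_ev_le[of x p] by simp
    then show "x = 0" by (intro bidisc_algebra_eqI) simp
  next
    assume "x = 0"
    then show "norm x = 0" by (simp add: norm_bidisc_algebra_def)
  qed
qed

end

instance bidisc_algebra :: banach
proof
  fix X :: "nat \<Rightarrow> bidisc_algebra"
  assume X: "Cauchy X"
  have "uniformly_Cauchy_on UNIV (\<lambda>n. ev (X n))"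
    unfolding uniformly_Cauchy_on_def
  proof (intro allI impI)
    fix e :: real assume "e > 0"
    with X obtain M where M: "\<And>m n. m \<ge> M \<Longrightarrow> n \<ge> M \<Longrightarrow> dist (X m) (X n) < e"
      unfolding Cauchy_def by blast
    have "dist (ev (X m) p) (ev (X n) p) < e" if "m \<ge> M" "n \<ge> M" for m n p
      using norm_ev_le[of "X m - X n" p] M[OF that] by (simp add: dist_norm)
    then show "\<exists>M. \<forall>p\<in>UNIV. \<forall>m\<ge>M. \<forall>n\<ge>M. dist (ev (X m) p) (ev (X n) p) < e" by blast
  qed
  then obtain g where g: "uniform_limit UNIV (\<lambda>n. ev (X n)) g sequentially"
    using Cauchy_uniformly_convergent uniformly_convergent_on_def by blast
  have "g \<in> bidisc_alg_set"
  proof (rule bidisc_alg_setI[where g = g])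
    show "continuous_on bidisc g"
    proof (rule uniform_limit_theorem)
      show "uniform_limit bidisc (\<lambda>n. ev (X n)) g sequentially"
        using g by (rule uniform_limit_on_subset) simp
      show "\<forall>\<^sub>F n in sequentially. continuous_on bidisc (ev (X n))"
        by (intro always_eventually allI bidisc_alg_setD(1)[OF ev])
    qed simp
    show "g p = 0" if "p \<notin> bidisc" for p
    proof -
      have "(\<lambda>n. ev (X n) p) \<longlonglongrightarrow> g p"
        using g by (rule tendsto_uniform_limitI) simp
      then show ?thesis
        by (simp add: ev_outside[OF that] LIMSEQ_const_iff)
    qed
    fix b :: complex assume b: "norm b < 1"
    have cb: "\<exists>d>0. cball x d \<subseteq> ball 0 1" if "x \<in> ball 0 1" for x :: complex
      using that open_contains_cball[of "ball (0::complex) 1"] by blast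
    have lim1: "uniform_limit K (\<lambda>n z. ev (X n) (z, b)) (\<lambda>z. g (z, b)) sequentially"
      and lim2: "uniform_limit K (\<lambda>n z. ev (X n) (b, z)) (\<lambda>z. g (b, z)) sequentially"
      for K :: "complex set"
      using g by (rule uniform_limit_compose'; simp)+
    show "(\<lambda>z. g (z, b)) holomorphic_on ball 0 1"
      using cb lim1
      by (intro holomorphic_uniform_sequence[where f = "\<lambda>n z. ev (X n) (z, b)",
            OF open_ball bidisc_alg_setD(2)[OF ev b]]) meson
    show "(\<lambda>z. g (b, z)) holomorphic_on ball 0 1"
      using cb lim2
      by (intro holomorphic_uniform_sequence[where f = "\<lambda>n z. ev (X n) (b, z)",
            OF open_ball bidisc_alg_setD(3)[OF ev b]]) meson
  qed auto
  then have g_eq: "ev (Abs_bidisc_algebra g) = g"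
    by (rule Abs_bidisc_algebra_inverse)
  have "X \<longlonglongrightarrow> Abs_bidisc_algebra g"
  proof (rule metric_LIMSEQ_I)
    fix e :: real assume "e > 0"
    then have "\<forall>\<^sub>F n in sequentially. \<forall>p\<in>UNIV. dist (ev (X n) p) (g p) < e / 2"
      using uniform_limitD[OF g, of "e / 2"] by simp
    then obtain N where N: "\<And>n p. n \<ge> N \<Longrightarrow> dist (ev (X n) p) (g p) < e / 2"
      by (auto simp: eventually_sequentially)
    have "dist (X n) (Abs_bidisc_algebra g) \<le> e / 2" if "n \<ge> N" for n
      unfolding dist_norm using N[OF that]
      by (intro norm_bidisc_algebra_le) (simp add: g_eq dist_norm less_imp_le)
    with \<open>e > 0\<close> show "\<exists>N. \<forall>n\<ge>N. dist (X n) (Abs_bidisc_algebra g) < e"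
      by (intro exI[of _ N]) force
  qed
  then show "convergent X" by (rule convergentI)
qed

instantiation bidisc_algebra :: complex_banach
begin

definition cscale_bidisc_algebra :: "complex \<Rightarrow> bidisc_algebra \<Rightarrow> bidisc_algebra" where
  "cscale_bidisc_algebra = bidisc_scale"

instance
  by standard
    (auto intro!: bidisc_algebra_eqI
      simp: cscale_bidisc_algebra_def scaleR_bidisc_algebra_def norm_bidisc_scale algebra_simps)

end


section \<open>Hyperbolic automorphisms of the disc\<close>

text \<open>A conformal automorphism of the open unit disc, extended continuously to the closed disc.
  The values of \<open>\<phi>\<close> outside the closed disc are irrelevant.\<close>

definition disc_automorphism :: "(complex \<Rightarrow> complex) \<Rightarrow> bool" where
  "disc_automorphism \<phi> \<longleftrightarrow>
     continuous_on (cball 0 1) \<phi> \<and> \<phi> holomorphic_on ball 0 1 \<and>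
     bij_betw \<phi> (ball 0 1) (ball 0 1) \<and>
     inv_into (ball 0 1) \<phi> holomorphic_on ball 0 1"

definition hyperbolic_automorphism :: "(complex \<Rightarrow> complex) \<Rightarrow> bool" where
  "hyperbolic_automorphism \<phi> \<longleftrightarrow>
     disc_automorphism \<phi> \<and>
     card {z \<in> cball 0 1. \<phi> z = z} = 2 \<and> {z \<in> cball 0 1. \<phi> z = z} \<subseteq> sphere 0 1"

text \<open>Derivatives at boundary points are taken within the closed disc.\<close>

definition attracting_fixed_point :: "(complex \<Rightarrow> complex) \<Rightarrow> complex \<Rightarrow> bool" where
  "attracting_fixed_point \<phi> a \<longleftrightarrow> a \<in> cball 0 1 \<and> \<phi> a = a \<and>
     (\<exists>d. (\<phi> has_field_derivative d) (at a within cball 0 1) \<and> norm d < 1)"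

definition repelling_fixed_point :: "(complex \<Rightarrow> complex) \<Rightarrow> complex \<Rightarrow> bool" where
  "repelling_fixed_point \<phi> a \<longleftrightarrow> a \<in> cball 0 1 \<and> \<phi> a = a \<and>
     (\<exists>d. (\<phi> has_field_derivative d) (at a within cball 0 1) \<and> norm d > 1)"


section \<open>Annuli\<close>

definition annulus :: "real \<Rightarrow> real \<Rightarrow> complex set" where
  "annulus r R = {l. r \<le> norm l \<and> norm l \<le> R}"

end

theory Submission
  imports Defs
begin

text \<open>
  Let \<open>\<Phi> = (\<phi>, \<psi>)\<close> act on the closed bidisc and write
  \<open>W n p = w p * w (\<Phi> p) * \<dots> * w (\<Phi>\<^sup>n\<^sup>-\<^sup>1 p)\<close>, so that
  \<open>T\<^sup>n f = W n * (f \<circ> \<Phi>\<^sup>n)\<close>.  A hyperbolic automorphism has north-south dynamics: every orbit of \<open>\<Phi>\<close>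
  converges in both time directions to one of the four corners \<open>(s\<^sub>i, t\<^sub>j)\<close>.  The assumed order
  of the four weights says that \<open>|w|\<close> at the backward limit of an orbit is never smaller than
  at its forward limit.  Everything follows from this.

  A solution of \<open>l f = T f\<close>, restricted to an orbit, grows in forward time if \<open>|l|\<close> exceeds the
  forward weight and in backward time if \<open>|l|\<close> is below the backward weight.  If \<open>|l|\<close> is none of
  the four corner weights, one of the two occurs on every orbit, and a compactness argument turns
  this into a lower bound for \<open>l - T\<close> (\<open>bounded_below_pencil\<close>).  If \<open>|l|\<close> is the weight of a corner,
  orbits starting near that corner linger there arbitrarily long; peak functions carried along
  such an orbit, with slowly varying coefficients, are approximate eigenfunctions
  (\<open>not_bounded_below_pencil\<close>).  The kernel of \<open>l - T\<close> is always zero (\<open>kernel_trivial\<close>), so by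
  the open mapping theorem \<open>l - T\<close> is upper semi-Fredholm exactly when it is bounded below.

  For the range, take a point \<open>p\<close> of the torus whose orbit runs from \<open>(s2, t2)\<close> to \<open>(s1, t1)\<close>.  If
  \<open>r < |l| < R\<close>, the functional \<open>f \<mapsto> \<Sum>k. W k p / l\<^sup>k * f (\<Phi>\<^sup>k p)\<close>, \<open>k\<close> ranging over the integers, converges
  exponentially and annihilates the range of \<open>l - T\<close>.  Different orbits give independent functionals,
  since a peak function at \<open>p\<close> isolates the coefficient of \<open>f p\<close>.  So the range has infinite
  codimension.  The proof below works with long finite pieces of these sums, which annihilate the
  range up to a small error; combined with the dual estimate
  \<open>lower_semi_fredholm_functional_estimate\<close> this also covers the two boundary circles
  (\<open>not_lower_semi_fredholm\<close>).

  Finally, \<open>l - T\<close> is bounded below for \<open>|l| < r\<close> and for \<open>|l| > R\<close>.  Along a connected set of parameters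
  where \<open>l - T\<close> is bounded below surjectivity is either everywhere or nowhere
  (\<open>surj_pencil_connected\<close>); it holds for \<open>l = 0\<close> because \<open>T\<close> is invertible, and for large \<open>l\<close>.  So the
  spectrum lies in the annulus.
\<close>

section \<open>Bounded below operators and semi-Fredholm operators\<close>

definition pencil :: "('a::complex_banach \<Rightarrow> 'a) \<Rightarrow> complex \<Rightarrow> 'a \<Rightarrow> 'a" where
  "pencil T l x = l *\<^sub>C x - T x"

definition bounded_below :: "('a::real_normed_vector \<Rightarrow> 'b::real_normed_vector) \<Rightarrow> bool" where
  "bounded_below A \<longleftrightarrow> (\<exists>\<delta>>0. \<forall>x. \<delta> * norm x \<le> norm (A x))"

lemma bounded_clinearD: "bounded_clinear A \<Longrightarrow> bounded_linear A"
  by (simp add: bounded_clinear_def)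

text \<open>The form of the Baire category theorem behind the open mapping theorem.\<close>
lemma Baire_cover:
  fixes Y :: "'a::complete_space set" and S :: "nat \<Rightarrow> 'a set"
  assumes Y: "closed Y" "Y \<noteq> {}" and cover: "Y = (\<Union>n. S n)"
  obtains n y \<rho> where "y \<in> Y" "\<rho> > 0" "Y \<inter> ball y \<rho> \<subseteq> closure (S n)"
proof -
  have "\<exists>n. top_of_set Y interior_of closure (S n) \<noteq> {}"
  proof (rule ccontr)
    assume *: "\<nexists>n. top_of_set Y interior_of closure (S n) \<noteq> {}"
    have cl: "closure (S n) \<subseteq> Y" for n
      using Y(1) cover by (intro closure_minimal) auto
    have "completely_metrizable_space (top_of_set Y)"
      using Y(1) by (simp add: completely_metrizable_space_closedin completely_metrizable_space_euclidean)
    then have "top_of_set Y interior_of \<Union>(range (\<lambda>n. closure (S n))) = {}"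
      using * cl by (intro Baire_category_alt) (simp_all add: closedin_closed_eq[OF Y(1)] image_iff, blast+)
    moreover have "\<Union>(range (\<lambda>n. closure (S n))) = Y"
      using cl cover closure_subset by fast
    ultimately show False
      using Y(2) by (simp add: interior_of_topspace[of "top_of_set Y", simplified])
  qed
  then obtain n y where "y \<in> top_of_set Y interior_of closure (S n)" by blast
  then obtain U where U: "openin (top_of_set Y) U" "y \<in> U" "U \<subseteq> closure (S n)"
    by (auto simp: interior_of_def)
  then obtain V where V: "open V" "U = Y \<inter> V" by (auto simp: openin_open)
  with U obtain \<rho> where "\<rho> > 0" "ball y \<rho> \<subseteq> V" by (auto elim: openE)
  with U V show thesis by (intro that[of y \<rho> n]) auto
qed

text \<open>The open mapping theorem for an injective operator.  Baire's theorem on the complete space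
  \<open>range A\<close> only solves \<open>A x = u\<close> up to an error \<open>norm u / 2\<close> with \<open>norm x \<le> K * norm u\<close>; iterating on the
  error and summing gives an exact solution, which by injectivity is the only one.\<close>
lemma bounded_below_if_closed_range:
  fixes A :: "'a::banach \<Rightarrow> 'b::banach"
  assumes A: "bounded_linear A" and cl: "closed (range A)" and inj: "\<And>x. A x = 0 \<Longrightarrow> x = 0"
  shows "bounded_below A"
proof -
  interpret bounded_linear A by (rule A)
  have "range A = (\<Union>n. A ` cball 0 (real n))"
  proof -
    have "\<exists>n. x \<in> cball 0 (real n)" for x :: 'a
      using real_arch_simple[of "norm x"] by auto
    then show ?thesis by blast
  qed
  then obtain n y \<rho> where y: "y \<in> range A" and \<rho>: "\<rho> > 0"
    and sub: "range A \<inter> ball y \<rho> \<subseteq> closure (A ` cball 0 (real n))"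
    using Baire_cover[OF cl] by (metis UNIV_not_empty image_is_empty)
  define K where "K = (4 * real n + 1) / \<rho>"
  have K: "K > 0" using \<rho> by (simp add: K_def add_nonneg_pos)
  \<comment> \<open>Both \<open>y\<close> and \<open>y + t *\<^sub>R u\<close> lie in the ball of radius \<open>\<rho>\<close>, so both are nearly attained on \<open>cball 0 n\<close>;
      the difference of the two preimages is a preimage of \<open>t *\<^sub>R u\<close> up to a small error.\<close>
  have step: "\<exists>x. norm x \<le> K * norm u \<and> norm (u - A x) \<le> norm u / 2" if u: "u \<in> range A" for u
  proof (cases "u = 0")
    case True
    then show ?thesis by (intro exI[of _ 0]) auto
  next
    case False
    define t where "t = \<rho> / (2 * norm u)"
    have t: "t > 0" "t * norm u = \<rho> / 2" using False \<rho> by (auto simp: t_def)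
    define e where "e = t * norm u / 4"
    have e: "e > 0" using t False by (simp add: e_def)
    have "y + t *\<^sub>R u \<in> range A"
      using y u by (auto simp flip: add scaleR)
    moreover have "y + t *\<^sub>R u \<in> ball y \<rho>"
      using t \<rho> by (simp add: dist_norm)
    ultimately obtain a where a: "norm a \<le> n" "norm (A a - (y + t *\<^sub>R u)) < e"
      using sub e by (fastforce simp: closure_approachable dist_norm)
    have "y \<in> closure (A ` cball 0 (real n))"
      using sub y \<rho> by auto
    then obtain b where b: "norm b \<le> n" "norm (A b - y) < e"
      using e by (fastforce simp: closure_approachable dist_norm)
    define x where "x = (1 / t) *\<^sub>R (a - b)"
    have "norm x \<le> (2 * n) / t"
      using norm_triangle_ineq4[of a b] a b t by (simp add: x_def divide_right_mono)
    also have "\<dots> = (4 * n / \<rho>) * norm u"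
      using t False \<rho> by (simp add: t_def)
    also have "\<dots> \<le> K * norm u"
      unfolding K_def using \<rho> by (intro mult_right_mono divide_right_mono) auto
    finally have x: "norm x \<le> K * norm u" .
    have "t *\<^sub>R (u - A x) = (A b - y) - (A a - (y + t *\<^sub>R u))"
      using t by (simp add: x_def scaleR diff algebra_simps)
    then have "norm (t *\<^sub>R (u - A x)) \<le> norm (A b - y) + norm (A a - (y + t *\<^sub>R u))"
      by (metis norm_triangle_ineq4)
    also have "\<dots> \<le> t * norm u / 2"
      using a b by (simp add: e_def)
    finally have "t * norm (u - A x) \<le> t * (norm u / 2)"
      using t(1) by (simp only: norm_scaleR abs_of_pos times_divide_eq_right)
    then have "norm (u - A x) \<le> norm u / 2"
      by (rule mult_le_cancel_left_pos[OF t(1), THEN iffD1])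
    with x show ?thesis by blast
  qed
  then obtain X where X: "\<And>u. u \<in> range A \<Longrightarrow> norm (X u) \<le> K * norm u"
     "\<And>u. u \<in> range A \<Longrightarrow> norm (u - A (X u)) \<le> norm u / 2"
    by metis
  have main: "norm x0 \<le> 2 * K * norm (A x0)" for x0
  proof -
    define u where "u k = ((\<lambda>v. v - A (X v)) ^^ k) (A x0)" for k
    have u0: "u 0 = A x0" and uS: "u (Suc k) = u k - A (X (u k))" for k by (simp_all add: u_def)
    have ran: "u k \<in> range A" for k
      by (induction k) (auto simp: u0 uS simp flip: diff)
    have nu: "norm (u k) \<le> norm (A x0) * (1/2) ^ k" for k
    proof (induction k)
      case (Suc k)
      have "norm (u (Suc k)) \<le> norm (u k) / 2" using X(2)[OF ran] by (simp add: uS)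
      with Suc show ?case by simp
    qed (simp add: u0)
    have nX: "norm (X (u k)) \<le> K * norm (A x0) * (1/2) ^ k" for k
    proof -
      have "norm (X (u k)) \<le> K * norm (u k)" using X(1)[OF ran] .
      also have "\<dots> \<le> K * (norm (A x0) * (1/2) ^ k)"
        using K by (intro mult_left_mono nu) simp
      finally show ?thesis by (simp only: mult.assoc)
    qed
    have geo: "(\<lambda>k. K * norm (A x0) * (1/2::real) ^ k) sums (K * norm (A x0) * 2)"
      using geometric_sums[of "1/2::real"] by (intro sums_mult) simp
    have sumX: "summable (\<lambda>k. norm (X (u k)))"
      using nX by (intro summable_comparison_test[OF _ sums_summable[OF geo]]) auto
    define x where "x = (\<Sum>k. X (u k))"
    have "(\<lambda>k. X (u k)) sums x"
      unfolding x_def using summable_norm_cancel[OF sumX] by (rule summable_sums)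
    then have "(\<lambda>k. A (X (u k))) sums A x" by (rule sums)
    moreover have "(\<lambda>k. A (X (u k))) sums A x0"
    proof -
      have "(\<lambda>k. norm (A x0) * (1/2::real) ^ k) \<longlonglongrightarrow> norm (A x0) * 0"
        by (intro tendsto_mult_left LIMSEQ_realpow_zero) auto
      then have null: "(\<lambda>k. norm (A x0) * (1/2::real) ^ k) \<longlonglongrightarrow> 0" by simp
      have "u \<longlonglongrightarrow> 0"
        by (rule Lim_null_comparison[OF _ null]) (simp add: nu)
      then have "(\<lambda>k. u k - u (Suc k)) sums (u 0 - 0)" by (rule telescope_sums')
      then show ?thesis by (simp add: uS u0)
    qed
    ultimately have "A x = A x0" by (rule sums_unique2)
    then have "A (x0 - x) = 0" by (simp add: diff)
    then have "x0 = x" using inj[of "x0 - x"] by simp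
    also have "norm x \<le> (\<Sum>k. norm (X (u k)))"
      unfolding x_def by (rule summable_norm[OF sumX])
    also have "\<dots> \<le> (\<Sum>k. K * norm (A x0) * (1/2::real) ^ k)"
      by (intro suminf_le nX sumX sums_summable[OF geo])
    also have "\<dots> = K * norm (A x0) * 2"
      by (rule sums_unique[OF geo, symmetric])
    finally show ?thesis by (simp add: mult_ac)
  qed
  show ?thesis
    unfolding bounded_below_def
  proof (intro exI conjI allI)
    show "1 / (2 * K) > 0" using K by simp
    show "1 / (2 * K) * norm x \<le> norm (A x)" for x
      using main[of x] K by (simp add: field_simps)
  qed
qed

lemma closed_range_if_bounded_below:
  fixes A :: "'a::banach \<Rightarrow> 'b::banach"
  assumes "bounded_linear A" "bounded_below A"
  shows "closed (range A)"
  using assms complete_isometric_image[of _ UNIV A]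
  by (auto simp: bounded_below_def complete_imp_closed complete_UNIV)

text \<open>If the range of \<open>A\<close> and the finite set \<open>B\<close> span the space, then by Baire's theorem every vector of
  norm less than some \<open>\<rho>\<close> is, up to closure, a difference of two vectors \<open>A x + b\<close> with \<open>norm x \<le> n\<close>.  A functional that vanishes
  on \<open>B\<close> sees only \<open>A x\<close>, so it is controlled by its composition with \<open>A\<close>.  Thus \<open>A\<close> cannot be lower
  semi-Fredholm if many functionals have small composition with \<open>A\<close>.\<close>
lemma lower_semi_fredholm_functional_estimate:
  fixes A :: "'a::complex_banach \<Rightarrow> 'a"
  assumes "lower_semi_fredholm A"
  obtains B C where "finite B" "C \<ge> 0"
    and "\<And>(\<nu> :: 'a \<Rightarrow> complex) e. \<lbrakk>bounded_linear \<nu>; \<And>c x. \<nu> (c *\<^sub>C x) = c * \<nu> x; \<And>b. b \<in> B \<Longrightarrow> \<nu> b = 0;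
            0 \<le> e; \<And>x. norm (\<nu> (A x)) \<le> e * norm x\<rbrakk> \<Longrightarrow> (\<And>y. norm (\<nu> y) \<le> C * e * norm y)"
proof -
  obtain B where A: "bounded_clinear A" and B: "finite B"
    and full: "{y + b | y b. y \<in> range A \<and> b \<in> cvec.span B} = UNIV"
    using assms unfolding lower_semi_fredholm_def by blast
  define S where "S n = {A x + b | x b. norm x \<le> real n \<and> b \<in> cvec.span B}" for n
  have "UNIV = (\<Union>n. S n)"
  proof -
    have "\<exists>n. v \<in> S n" for v
    proof -
      obtain x b where "v = A x + b" "b \<in> cvec.span B" using full by blast
      moreover obtain n where "norm x \<le> real n" using real_arch_simple by blast
      ultimately show ?thesis unfolding S_def by blast
    qed
    then show ?thesis by blast
  qed
  then obtain n y \<rho> where \<rho>: "\<rho> > 0" and sub: "ball y \<rho> \<subseteq> closure (S n)"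
    using Baire_cover[OF closed_UNIV UNIV_not_empty] by (metis Int_UNIV_left)
  show thesis
  proof
    show "finite B" by (rule B)
    show "0 \<le> 4 * real n / \<rho>" using \<rho> by simp
    fix \<nu> :: "'a \<Rightarrow> complex" and e v
    assume \<nu>: "bounded_linear \<nu>" "\<And>c x. \<nu> (c *\<^sub>C x) = c * \<nu> x" "\<And>b. b \<in> B \<Longrightarrow> \<nu> b = 0"
      and e: "0 \<le> e" "\<And>x. norm (\<nu> (A x)) \<le> e * norm x"
    interpret bounded_linear \<nu> by (rule \<nu>(1))
    have span: "\<nu> b = 0" if "b \<in> cvec.span B" for b
      using that by (induction rule: cvec.span_induct_alt) (simp_all add: zero add \<nu>(2,3))
    have bd: "norm (\<nu> u) \<le> e * n" if "u \<in> closure (S n)" for u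
    proof -
      have "closed {u. norm (\<nu> u) \<le> e * n}"
        by (intro closed_Collect_le continuous_intros linear_continuous_on \<nu>(1))
      moreover have "S n \<subseteq> {u. norm (\<nu> u) \<le> e * n}"
        unfolding S_def using e order_trans[OF e(2) mult_left_mono[OF _ e(1)]]
        by (auto simp: add span)
      ultimately show ?thesis using that closure_minimal by blast
    qed
    show "norm (\<nu> v) \<le> 4 * real n / \<rho> * e * norm v"
    proof (cases "v = 0")
      case True
      then show ?thesis by (simp add: zero)
    next
      case False
      define t where "t = \<rho> / (2 * norm v)"
      have t: "t > 0" using False \<rho> by (simp add: t_def)
      have "y + t *\<^sub>R v \<in> ball y \<rho>" "y \<in> ball y \<rho>"
        using \<rho> False by (auto simp: dist_norm t_def)
      then have "norm (\<nu> (y + t *\<^sub>R v)) \<le> e * n" "norm (\<nu> y) \<le> e * n"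
        using bd sub by blast+
      then have "norm (\<nu> (y + t *\<^sub>R v) - \<nu> y) \<le> 2 * (e * n)"
        using norm_triangle_ineq4[of "\<nu> (y + t *\<^sub>R v)" "\<nu> y"] by linarith
      then have "t * norm (\<nu> v) \<le> 2 * (e * n)"
        using t by (simp add: add scaleR)
      then have "norm (\<nu> v) \<le> 2 * (e * n) / t" using t by (simp add: field_simps)
      then show ?thesis using \<rho> False by (simp add: t_def field_simps)
    qed
  qed
qed

text \<open>With \<open>G\<close> a right inverse of \<open>A\<close>, a solution of \<open>A' x = y\<close> is a fixed point of
  \<open>x \<mapsto> G (y - (A' x - A x))\<close>, a contraction with constant \<open>\<eta> / \<delta>\<close>.\<close>
lemma surj_perturbation:
  fixes A A' :: "'a::banach \<Rightarrow> 'b::real_normed_vector"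
  assumes A: "bounded_linear A" "surj A" "\<And>x. \<delta> * norm x \<le> norm (A x)"
    and A': "bounded_linear A'" "\<And>x. norm (A' x - A x) \<le> \<eta> * norm x" and \<eta>: "0 \<le> \<eta>" "\<eta> < \<delta>"
  shows "surj A'"
proof -
  interpret A: bounded_linear A by (rule A(1))
  interpret A': bounded_linear A' by (rule A'(1))
  define G where "G = inv A"
  have AG: "A (G y) = y" for y unfolding G_def by (rule surj_f_inv_f[OF A(2)])
  have "\<exists>x. A' x = y" for y
  proof -
    define F where "F x = G (y - (A' x - A x))" for x
    have lip: "dist (F x) (F x') \<le> (\<eta> / \<delta>) * dist x x'" for x x'
    proof -
      have "\<delta> * norm (F x - F x') \<le> norm (A (F x - F x'))" by (rule A(3))
      also have "A (F x - F x') = - (A' (x - x') - A (x - x'))"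
        by (simp add: A.diff A'.diff F_def AG)
      also have "norm \<dots> \<le> \<eta> * norm (x - x')" using A'(2) norm_minus_cancel by metis
      finally show ?thesis using \<eta> by (simp add: dist_norm field_simps)
    qed
    have "\<exists>!x. F x = x"
      using \<eta> lip by (intro banach_fix_type[of "\<eta> / \<delta>"]) auto
    then obtain x where "F x = x" by blast
    then have "A x = y - (A' x - A x)" using AG by (metis F_def)
    then have "A' x = y" by simp
    then show ?thesis ..
  qed
  then show ?thesis by (metis surjI)
qed

lemma bounded_clinear_cscale: "bounded_clinear (\<lambda>x. l *\<^sub>C x)"
  unfolding bounded_clinear_def
proof (intro conjI allI)
  show "bounded_linear (\<lambda>x::'a. l *\<^sub>C x)"
    by (intro bounded_linear_intro[where K = "norm l"])
       (simp_all add: cscale_right_distrib norm_cscale mult.commute cscale_cscale flip: cscale_of_real)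
qed (simp add: cscale_cscale mult.commute)

lemma bounded_clinear_pencil:
  assumes "bounded_clinear T"
  shows "bounded_clinear (pencil T l)"
  using assms bounded_clinear_cscale[of l] unfolding bounded_clinear_def pencil_def
  by (auto intro!: bounded_linear_sub simp: cvec.scale_right_diff_distrib)

text \<open>By the perturbation lemma, the parameters with surjective pencil form a relatively open subset, and so
  do the others: the lower bound at a given parameter persists nearby, with almost the same constant.\<close>
lemma surj_pencil_connected:
  fixes T :: "'a::complex_banach \<Rightarrow> 'a"
  assumes T: "bounded_clinear T" and S: "connected S" and bb: "\<And>l. l \<in> S \<Longrightarrow> bounded_below (pencil T l)"
    and l0: "l0 \<in> S" "surj (pencil T l0)" and l: "l \<in> S"
  shows "surj (pencil T l)"
proof -
  have lin: "bounded_linear (pencil T m)" for m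
    using bounded_clinear_pencil[OF T] by (simp add: bounded_clinear_def)
  have diff: "pencil T m x - pencil T m' x = (m - m') *\<^sub>C x" for m m' x
    by (simp add: pencil_def cvec.scale_left_diff_distrib)
  define U where "U = {m \<in> S. surj (pencil T m)}"
  have nbhd: "\<exists>e>0. \<forall>m'\<in>S. dist m' m < e \<longrightarrow> (surj (pencil T m') \<longleftrightarrow> surj (pencil T m))" if m: "m \<in> S" for m
  proof -
    obtain \<delta> where \<delta>: "\<delta> > 0" "\<And>x. \<delta> * norm x \<le> norm (pencil T m x)"
      using bb[OF m] by (auto simp: bounded_below_def)
    have *: "surj (pencil T m') \<longleftrightarrow> surj (pencil T m)" if m': "dist m' m < \<delta> / 2" for m'
    proof
      have near: "norm (pencil T m x - pencil T m' x) = dist m' m * norm x" for x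
        unfolding diff by (simp add: norm_cscale dist_norm norm_minus_commute)
      have "(\<delta> - dist m' m) * norm x \<le> norm (pencil T m' x)" for x
        using \<delta>(2)[of x] near[of x] norm_triangle_ineq2[of "pencil T m x" "pencil T m' x"]
        unfolding left_diff_distrib by linarith
      then have bb': "\<And>x. (\<delta> - dist m' m) * norm x \<le> norm (pencil T m' x)" .
      have near': "norm (pencil T m' x - pencil T m x) \<le> dist m' m * norm x" for x
        by (metis near norm_minus_commute order_refl)
      have d: "dist m' m < \<delta> - dist m' m" "dist m' m < \<delta>" using m' \<delta>(1) by linarith+
      show "surj (pencil T m)" if "surj (pencil T m')"
        by (rule surj_perturbation[OF lin[of m'] that bb' lin[of m] _ zero_le_dist d(1)]) (simp only: near order_refl)
      show "surj (pencil T m')" if "surj (pencil T m)"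
        by (rule surj_perturbation[OF lin[of m] that \<delta>(2) lin[of m'] near' zero_le_dist d(2)])
    qed
    show ?thesis
    proof (intro exI conjI ballI impI)
      show "\<delta> / 2 > 0" using \<delta>(1) by simp
    qed (rule *)
  qed
  have "openin (top_of_set S) U" "openin (top_of_set S) (S - U)"
    unfolding openin_euclidean_subtopology_iff U_def using nbhd by (blast, blast)
  then have "U = {} \<or> S - U = {}"
    using S unfolding connected_openin
    by (metis Diff_disjoint Un_Diff_cancel Un_upper2)
  then show ?thesis using l0 l by (auto simp: U_def)
qed

lemma op_invertible_pencil:
  assumes T: "bounded_clinear T" and bb: "bounded_below (pencil T l)" and s: "surj (pencil T l)"
  shows "op_invertible (pencil T l)"
proof -
  let ?A = "pencil T l"
  have A: "bounded_clinear ?A" by (rule bounded_clinear_pencil[OF T])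
  then interpret bounded_linear ?A by (simp add: bounded_clinear_def)
  have Ac: "?A (c *\<^sub>C x) = c *\<^sub>C ?A x" for c x using A by (simp add: bounded_clinear_def)
  obtain \<delta> where \<delta>: "\<delta> > 0" "\<And>x. \<delta> * norm x \<le> norm (?A x)"
    using bb by (auto simp: bounded_below_def)
  have inj: "inj ?A"
  proof (rule injI)
    fix x y assume "?A x = ?A y"
    then have "\<delta> * norm (x - y) \<le> 0" using \<delta>(2)[of "x - y"] by (simp add: diff)
    then show "x = y" using \<delta>(1) by (simp add: mult_le_0_iff)
  qed
  define G where "G = inv ?A"
  have AG: "?A (G y) = y" and GA: "G (?A x) = x" for x y
    unfolding G_def using inj s by (auto simp: surj_f_inv_f)
  have eq: "G y = x \<longleftrightarrow> y = ?A x" for x y using AG GA by metis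
  have "bounded_linear G"
  proof (rule bounded_linear_intro[where K = "1 / \<delta>"])
    show "G (x + y) = G x + G y" "G (r *\<^sub>R x) = r *\<^sub>R G x" for x y r
      unfolding eq by (simp_all add: add scaleR AG)
    show "norm (G x) \<le> norm x * (1 / \<delta>)" for x
      using \<delta>(2)[of "G x"] \<delta>(1) by (simp add: AG field_simps)
  qed
  moreover have "G (c *\<^sub>C x) = c *\<^sub>C G x" for c x
    unfolding eq by (simp add: Ac AG)
  ultimately have "bounded_clinear G" by (simp add: bounded_clinear_def)
  then show ?thesis
    unfolding op_invertible_def using A AG GA by (auto intro!: exI[of _ G] simp: fun_eq_iff)
qed

text \<open>Gaussian elimination: one unknown is used up by each equation.\<close>
lemma homogeneous_system_nontrivial_solution:
  fixes M :: "'i \<Rightarrow> 'j \<Rightarrow> 'f::field"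
  assumes "finite B" "finite I" "card B < card I"
  shows "\<exists>\<alpha>. (\<exists>i\<in>I. \<alpha> i \<noteq> 0) \<and> (\<forall>b\<in>B. (\<Sum>i\<in>I. \<alpha> i * M i b) = 0)"
  using assms
proof (induction B arbitrary: I M rule: finite_induct)
  case empty
  then obtain i where "i \<in> I" by fastforce
  then show ?case by (intro exI[of _ "\<lambda>_. 1"]) auto
next
  case (insert b B)
  show ?case
  proof (cases "\<forall>i\<in>I. M i b = 0")
    case True
    obtain \<alpha> where "\<exists>i\<in>I. \<alpha> i \<noteq> 0" "\<forall>b\<in>B. (\<Sum>i\<in>I. \<alpha> i * M i b) = 0"
      using insert.IH[of I M] insert.prems insert.hyps by auto
    then show ?thesis using True by (intro exI[of _ \<alpha>]) auto
  next
    case False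
    then obtain k where k: "k \<in> I" "M k b \<noteq> 0" by blast
    define J where "J = I - {k}"
    define N where "N i c = M i c - M i b / M k b * M k c" for i c
    have "card B < card J" "finite J"
      using insert.prems insert.hyps k by (auto simp: J_def)
    then obtain \<alpha> where \<alpha>: "\<exists>i\<in>J. \<alpha> i \<noteq> 0" "\<And>c. c \<in> B \<Longrightarrow> (\<Sum>i\<in>J. \<alpha> i * N i c) = 0"
      using insert.IH[of J N] by auto
    define \<beta> where "\<beta> = \<alpha>(k := - (\<Sum>i\<in>J. \<alpha> i * M i b / M k b))"
    have sum: "(\<Sum>i\<in>I. \<beta> i * M i c) = (\<Sum>i\<in>J. \<alpha> i * N i c)" for c
    proof -
      have "(\<Sum>i\<in>I. \<beta> i * M i c) = \<beta> k * M k c + (\<Sum>i\<in>J. \<beta> i * M i c)"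
        unfolding J_def using insert.prems(1) k(1) by (rule sum.remove)
      also have "(\<Sum>i\<in>J. \<beta> i * M i c) = (\<Sum>i\<in>J. \<alpha> i * M i c)"
        by (intro sum.cong) (auto simp: \<beta>_def J_def)
      also have "\<beta> k * M k c = - (\<Sum>i\<in>J. \<alpha> i * (M i b / M k b * M k c))"
        by (simp add: \<beta>_def sum_distrib_right mult.assoc)
      finally show ?thesis by (simp add: N_def algebra_simps sum_subtractf)
    qed
    have "N i b = 0" for i using k by (simp add: N_def)
    then have "(\<Sum>i\<in>I. \<beta> i * M i c) = 0" if "c \<in> insert b B" for c
      using that \<alpha>(2) by (auto simp: sum)
    moreover have "\<exists>i\<in>I. \<beta> i \<noteq> 0" using \<alpha>(1) by (auto simp: \<beta>_def J_def)
    ultimately show ?thesis by blast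
  qed
qed

section \<open>North-south dynamics of hyperbolic automorphisms\<close>

text \<open>After composing with a Moebius function that sends \<open>\<phi> 0\<close> to \<open>0\<close>, the Schwarz lemma for the map and for
  its inverse leaves only a rotation.  Continuity extends the formula to the closed disc.\<close>
lemma disc_automorphism_moebius:
  assumes "disc_automorphism \<phi>"
  obtains a \<alpha> where "norm a < 1" "norm \<alpha> = 1"
    "\<And>z. z \<in> cball 0 1 \<Longrightarrow> \<phi> z = (\<alpha> * z + a) / (1 + cnj a * \<alpha> * z)"
    "\<And>z. z \<in> cball 0 1 \<Longrightarrow> 1 + cnj a * \<alpha> * z \<noteq> 0"
proof -
  define \<phi>i where "\<phi>i = inv_into (ball 0 1) \<phi>"
  have cont: "continuous_on (cball 0 1) \<phi>" and hol: "\<phi> holomorphic_on ball 0 1"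
    and bij: "bij_betw \<phi> (ball 0 1) (ball 0 1)" and holi: "\<phi>i holomorphic_on ball 0 1"
    using assms by (auto simp: disc_automorphism_def \<phi>i_def)
  have \<phi>_ball: "\<phi> z \<in> ball 0 1" if "z \<in> ball 0 1" for z
    using bij that by (rule bij_betwE[rule_format])
  have \<phi>i_ball: "\<phi>i z \<in> ball 0 1" if "z \<in> ball 0 1" for z
    using bij that unfolding \<phi>i_def by (metis bij_betw_def inv_into_into)
  have \<phi>i\<phi>: "\<phi>i (\<phi> z) = z" if "z \<in> ball 0 1" for z
    using bij that unfolding \<phi>i_def by (rule bij_betw_inv_into_left)
  define a where "a = \<phi> 0"
  have a: "norm a < 1" using \<phi>_ball[of 0] by (simp add: a_def)
  define f where "f z = Moebius_function 0 a (\<phi> z)" for z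
  define g where "g z = \<phi>i (Moebius_function 0 (- a) z)" for z
  have f: "f holomorphic_on ball 0 1" "f 0 = 0" "\<And>z. norm z < 1 \<Longrightarrow> norm (f z) < 1"
  proof -
    have "Moebius_function 0 a \<circ> \<phi> holomorphic_on ball 0 1"
      using \<phi>_ball by (intro holomorphic_on_compose_gen[OF hol Moebius_function_holomorphic[OF a]]) auto
    then show "f holomorphic_on ball 0 1" by (simp add: f_def[abs_def] o_def)
    show "f 0 = 0" by (simp add: f_def a_def Moebius_function_eq_zero)
    show "norm (f z) < 1" if "norm z < 1" for z
      using Moebius_function_norm_lt_1[OF a, of "\<phi> z"] \<phi>_ball[of z] that by (simp add: f_def)
  qed
  have na: "norm (- a) < 1" using a by simp
  have g: "g holomorphic_on ball 0 1" "g 0 = 0" "\<And>z. norm z < 1 \<Longrightarrow> norm (g z) < 1"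
  proof -
    have "\<phi>i \<circ> Moebius_function 0 (- a) holomorphic_on ball 0 1"
      using Moebius_function_norm_lt_1[OF na]
      by (intro holomorphic_on_compose_gen[OF Moebius_function_holomorphic[OF na] holi]) auto
    then show "g holomorphic_on ball 0 1" by (simp add: g_def[abs_def] o_def)
    show "g 0 = 0" using \<phi>i\<phi>[of 0] by (simp add: g_def a_def Moebius_function_simple)
    show "norm (g z) < 1" if "norm z < 1" for z
      using Moebius_function_norm_lt_1[OF na that] \<phi>i_ball by (simp add: g_def)
  qed
  have inv: "\<phi> z = Moebius_function 0 (- a) (f z)" if "norm z < 1" for z
    unfolding f_def using Moebius_function_compose[of "- a" a] a \<phi>_ball[of z] that by simp
  have "g (f z) = z" if "norm z < 1" for z
    using \<phi>i\<phi>[of z] that by (simp add: g_def flip: inv)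
  then have "norm z \<le> norm (f z)" if "norm z < 1" for z
    using Schwarz_Lemma(1)[OF g f(3)[OF that]] that by simp
  from this[of "1/2"] have "norm (f (1/2)) = norm (1/2::complex)"
    using Schwarz_Lemma(1)[OF f, of "1/2"] by (intro antisym) auto
  then have "\<exists>z. norm z < 1 \<and> z \<noteq> 0 \<and> norm (f z) = norm z"
    by (intro exI[of _ "1/2"]) simp
  then obtain \<alpha> where \<alpha>: "\<And>z. norm z < 1 \<Longrightarrow> f z = \<alpha> * z" "norm \<alpha> = 1"
    using Schwarz_Lemma(3)[OF f, of 0] by auto
  have den: "1 + cnj a * \<alpha> * z \<noteq> 0" if "z \<in> cball 0 1" for z
  proof
    assume "1 + cnj a * \<alpha> * z = 0"
    then have "norm (cnj a * \<alpha> * z) = 1" by (metis add.inverse_unique norm_minus_cancel norm_one)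
    then have "norm a * norm z = 1" using \<alpha>(2) by (simp add: norm_mult)
    moreover have "norm a * norm z \<le> norm a * 1" using that by (intro mult_left_mono) auto
    ultimately show False using a by simp
  qed
  have "\<phi> z - (\<alpha> * z + a) / (1 + cnj a * \<alpha> * z) = 0" if "z \<in> cball 0 1" for z
  proof (rule continuous_constant_on_closure[of "ball 0 1" "\<lambda>z. \<phi> z - (\<alpha> * z + a) / (1 + cnj a * \<alpha> * z)"])
    show "continuous_on (closure (ball 0 1)) (\<lambda>z. \<phi> z - (\<alpha> * z + a) / (1 + cnj a * \<alpha> * z))"
      using den cont by (simp, intro continuous_intros) auto
    show "\<phi> z - (\<alpha> * z + a) / (1 + cnj a * \<alpha> * z) = 0" if "z \<in> ball 0 1" for z
      using inv[of z] \<alpha>(1)[of z] that by (simp add: Moebius_function_simple mult.assoc)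
    show "z \<in> closure (ball 0 1)" using that by simp
  qed
  then show thesis using that[OF a \<alpha>(2)] den by auto
qed

text \<open>In the coordinate \<open>(z - a) / (z - b)\<close> the map is multiplication by \<open>\<kappa>\<close>.\<close>
lemma moebius_orbit_tendsto:
  fixes f :: "complex \<Rightarrow> complex"
  assumes step: "\<And>z. \<lbrakk>z \<in> S; z \<noteq> b\<rbrakk> \<Longrightarrow> f z \<in> S \<and> f z \<noteq> b \<and> (f z - a) * (z - b) = \<kappa> * (f z - b) * (z - a)"
    and \<kappa>: "norm \<kappa> < 1" and ab: "a \<noteq> b" and z: "z \<in> S" "z \<noteq> b"
  shows "(\<lambda>n. (f ^^ n) z) \<longlonglongrightarrow> a"
proof -
  define g where "g z = (z - a) / (z - b)" for z
  have orb: "(f ^^ n) z \<in> S \<and> (f ^^ n) z \<noteq> b \<and> g ((f ^^ n) z) = \<kappa> ^ n * g z" for n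
  proof (induction n)
    case (Suc n)
    define u where "u = (f ^^ n) z"
    have u: "u \<in> S" "u \<noteq> b" "g u = \<kappa> ^ n * g z" using Suc by (auto simp: u_def)
    have "g (f u) = \<kappa> * g u" using step[OF u(1,2)] u(2) by (simp add: g_def field_simps)
    then show ?case using step[OF u(1,2)] u(3) by (simp add: u_def)
  qed (use z in simp)
  have "(\<lambda>n. \<kappa> ^ n * g z) \<longlonglongrightarrow> 0 * g z"
    by (intro tendsto_intros LIMSEQ_power_zero \<kappa>)
  then have lim: "(\<lambda>n. \<kappa> ^ n * g z) \<longlonglongrightarrow> 0" by simp
  have "(\<lambda>n. (a - b * (\<kappa> ^ n * g z)) / (1 - \<kappa> ^ n * g z)) \<longlonglongrightarrow> (a - b * 0) / (1 - 0)"
    by (intro tendsto_intros lim) auto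
  moreover have "(a - b * (\<kappa> ^ n * g z)) / (1 - \<kappa> ^ n * g z) = (f ^^ n) z" for n
  proof -
    define u where "u = (f ^^ n) z"
    have "u \<noteq> b" "\<kappa> ^ n * g z = g u" using orb[of n] by (auto simp: u_def)
    moreover have "1 - g u \<noteq> 0" "(a - b * g u) = u * (1 - g u)"
      using \<open>u \<noteq> b\<close> ab by (auto simp: g_def field_simps)
    ultimately show ?thesis by (simp add: u_def)
  qed
  ultimately show ?thesis by simp
qed

text \<open>The dynamics of a hyperbolic automorphism \<open>\<phi>\<close> and of its inverse \<open>\<phi>'\<close> on the closed disc, without reference
  to the multiplier at the fixed points.\<close>
locale north_south =
  fixes \<phi> \<phi>' :: "complex \<Rightarrow> complex" and s1 s2 :: complex
  assumes attracting: "s1 \<in> sphere 0 1" "\<phi> s1 = s1" and repelling: "s2 \<in> sphere 0 1" "\<phi> s2 = s2"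
    and distinct: "s1 \<noteq> s2"
    and cball: "z \<in> cball 0 1 \<Longrightarrow> \<phi> z \<in> cball 0 1" "z \<in> cball 0 1 \<Longrightarrow> \<phi>' z \<in> cball 0 1"
    and inverse: "z \<in> cball 0 1 \<Longrightarrow> \<phi>' (\<phi> z) = z" "z \<in> cball 0 1 \<Longrightarrow> \<phi> (\<phi>' z) = z"
    and ball: "z \<in> ball 0 1 \<Longrightarrow> \<phi> z \<in> ball 0 1" "z \<in> ball 0 1 \<Longrightarrow> \<phi>' z \<in> ball 0 1"
    and continuous: "continuous_on (cball 0 1) \<phi>" "continuous_on (cball 0 1) \<phi>'"
    and holomorphic: "\<phi> holomorphic_on ball 0 1" "\<phi>' holomorphic_on ball 0 1"
    and forward: "\<lbrakk>z \<in> cball 0 1; z \<noteq> s2\<rbrakk> \<Longrightarrow> (\<lambda>n. (\<phi> ^^ n) z) \<longlonglongrightarrow> s1"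
    and backward: "\<lbrakk>z \<in> cball 0 1; z \<noteq> s1\<rbrakk> \<Longrightarrow> (\<lambda>n. (\<phi>' ^^ n) z) \<longlonglongrightarrow> s2"

text \<open>For a Moebius map with fixed points \<open>s1\<close> and \<open>s2\<close> the quotient \<open>(z - s1) / (z - s2)\<close> is multiplied by a
  constant \<open>\<kappa>\<close>.  This constant is the derivative at \<open>s1\<close>, hence of modulus less than \<open>1\<close>, and the inverse map
  multiplies the reciprocal quotient by the same constant.\<close>
lemma hyperbolic_north_south:
  assumes hyp: "hyperbolic_automorphism \<phi>" and att: "attracting_fixed_point \<phi> s1"
    and rep: "repelling_fixed_point \<phi> s2"
  obtains \<phi>' where "north_south \<phi> \<phi>' s1 s2"
proof -
  have dA: "disc_automorphism \<phi>" and fixed: "{z \<in> cball 0 1. \<phi> z = z} \<subseteq> sphere 0 1"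
    using hyp by (auto simp: hyperbolic_automorphism_def)
  have s1: "s1 \<in> sphere 0 1" "\<phi> s1 = s1" and s2: "s2 \<in> sphere 0 1" "\<phi> s2 = s2"
    using att rep fixed by (auto simp: attracting_fixed_point_def repelling_fixed_point_def)
  have s1c: "s1 \<in> cball 0 1" and s2c: "s2 \<in> cball 0 1" using s1 s2 by auto
  obtain d1 where d1: "(\<phi> has_field_derivative d1) (at s1 within cball 0 1)" "norm d1 < 1"
    using att by (auto simp: attracting_fixed_point_def)
  obtain d2 where d2: "(\<phi> has_field_derivative d2) (at s2 within cball 0 1)" "norm d2 > 1"
    using rep by (auto simp: repelling_fixed_point_def)
  have "s1 islimpt cball 0 1"
    using s1 by (intro islimpt_subset[OF _ ball_subset_cball]) (simp add: islimpt_ball)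
  then have nontriv: "at s1 within cball 0 1 \<noteq> bot" by (simp add: trivial_limit_within)
  have ne: "s1 \<noteq> s2"
  proof
    assume "s1 = s2"
    then have "d1 = d2"
      using d1(1) d2(1) by (auto simp: has_field_derivative_iff intro: tendsto_unique[OF nontriv])
    then show False using d1 d2 by simp
  qed
  have cont: "continuous_on (cball 0 1) \<phi>" and hol: "\<phi> holomorphic_on ball 0 1"
    and bij: "bij_betw \<phi> (ball 0 1) (ball 0 1)" and holi: "inv_into (ball 0 1) \<phi> holomorphic_on ball 0 1"
    using dA by (auto simp: disc_automorphism_def)
  obtain a \<alpha> where a: "norm a < 1" "norm \<alpha> = 1"
    and \<phi>: "\<And>z. z \<in> cball 0 1 \<Longrightarrow> \<phi> z = (\<alpha> * z + a) / (1 + cnj a * \<alpha> * z)"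
    and den: "\<And>z. z \<in> cball 0 1 \<Longrightarrow> 1 + cnj a * \<alpha> * z \<noteq> 0"
    using disc_automorphism_moebius[OF dA] by metis
  define D where "D z = 1 + cnj a * \<alpha> * z" for z
  define c where "c = \<alpha> * (1 - a * cnj a)"
  have "norm (a * cnj a) \<noteq> 1"
    using a(1) norm_mult_less[of a 1 "cnj a" 1] by auto
  then have c0: "c \<noteq> 0" using a by (auto simp: c_def)
  have D0: "D z \<noteq> 0" if "z \<in> cball 0 1" for z using den[OF that] by (simp add: D_def)
  have diff: "(\<phi> z - \<phi> z') * D z * D z' = c * (z - z')" if "z \<in> cball 0 1" "z' \<in> cball 0 1" for z z'
  proof -
    have e: "\<phi> z * D z = \<alpha> * z + a" "\<phi> z' * D z' = \<alpha> * z' + a"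
      using \<phi>[OF that(1)] \<phi>[OF that(2)] D0[OF that(1)] D0[OF that(2)] by (simp_all flip: D_def)
    have "(\<phi> z - \<phi> z') * D z * D z' = (\<phi> z * D z) * D z' - (\<phi> z' * D z') * D z"
      by (simp add: algebra_simps)
    also have "\<dots> = c * (z - z')"
      unfolding e by (simp add: c_def D_def algebra_simps)
    finally show ?thesis .
  qed
  have inj: "inj_on \<phi> (cball 0 1)"
  proof (rule inj_onI)
    fix z z' assume "z \<in> cball 0 1" "z' \<in> cball 0 1" "\<phi> z = \<phi> z'"
    then show "z = z'" using diff[of z z'] c0 by simp
  qed
  \<comment> \<open>Divide the identity \<open>diff\<close> for the pair \<open>z, s1\<close> by the one for \<open>z, s2\<close>.\<close>
  define \<kappa> where "\<kappa> = D s2 / D s1"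
  have \<kappa>eq: "(\<phi> z - s1) * (z - s2) = \<kappa> * (\<phi> z - s2) * (z - s1)" if z: "z \<in> cball 0 1" for z
  proof -
    have e: "(\<phi> z - s1) * D z * D s1 = c * (z - s1)" "(\<phi> z - s2) * D z * D s2 = c * (z - s2)"
      using diff[OF z s1c] diff[OF z s2c] s1 s2 by auto
    have "c * D z * ((\<phi> z - s1) * (z - s2) * D s1) = ((\<phi> z - s1) * D z * D s1) * (c * (z - s2))"
      by (simp add: algebra_simps)
    also have "\<dots> = c * D z * ((\<phi> z - s2) * D s2 * (z - s1))"
      unfolding e(1) e(2)[symmetric] by (simp add: algebra_simps)
    finally have "(\<phi> z - s1) * (z - s2) * D s1 = (\<phi> z - s2) * D s2 * (z - s1)"
      using c0 D0[OF z] by simp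
    then show ?thesis using D0[OF s1c] by (simp add: \<kappa>_def field_simps)
  qed
  have \<kappa>: "norm \<kappa> < 1"
  proof -
    have lim1: "((\<lambda>z. (\<phi> z - \<phi> s1) / (z - s1)) \<longlongrightarrow> d1) (at s1 within cball 0 1)"
      using d1(1) by (simp add: has_field_derivative_iff)
    have lim2: "((\<lambda>z. \<kappa> * (\<phi> z - s2) / (z - s2)) \<longlongrightarrow> \<kappa> * (s1 - s2) / (s1 - s2)) (at s1 within cball 0 1)"
    proof (intro tendsto_intros)
      show "(\<phi> \<longlongrightarrow> s1) (at s1 within cball 0 1)"
        using cont s1c s1(2) unfolding continuous_on_def by metis
    qed (use ne in auto)
    have ev: "\<forall>\<^sub>F z in at s1 within cball 0 1. \<kappa> * (\<phi> z - s2) / (z - s2) = (\<phi> z - \<phi> s1) / (z - s1)"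
    proof -
      have "\<forall>\<^sub>F z in at s1 within cball 0 1. z \<in> cball 0 1 \<and> z \<noteq> s1 \<and> z \<noteq> s2"
        unfolding eventually_at using ne by (intro exI[of _ "dist s1 s2"]) (auto simp: dist_commute)
      then show ?thesis
      proof eventually_elim
        case (elim z)
        then show ?case using \<kappa>eq[of z] s1 by (simp add: field_simps)
      qed
    qed
    have "d1 = \<kappa> * (s1 - s2) / (s1 - s2)"
      by (rule tendsto_unique[OF nontriv lim1 Lim_transform_eventually[OF lim2 ev]])
    then show ?thesis using d1(2) ne by simp
  qed
  have img: "\<phi> ` cball 0 1 = cball 0 1"
  proof
    have "\<phi> ` closure (ball 0 1) \<subseteq> closure (\<phi> ` ball 0 1)"
      using cont by (intro image_closure_subset) (auto intro: subsetD[OF closure_subset])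
    then show "\<phi> ` cball 0 1 \<subseteq> cball 0 1"
      using bij by (simp add: bij_betw_def)
    have "closed (\<phi> ` cball 0 1)"
      using cont by (intro compact_imp_closed compact_continuous_image) auto
    moreover have "ball 0 1 \<subseteq> \<phi> ` cball 0 1"
      using bij ball_subset_cball by (metis bij_betw_def image_mono)
    ultimately have "closure (ball 0 1) \<subseteq> \<phi> ` cball 0 1" by (intro closure_minimal)
    then show "cball 0 1 \<subseteq> \<phi> ` cball 0 1" by simp
  qed
  define \<phi>' where "\<phi>' = inv_into (cball 0 1) \<phi>"
  have inv1: "\<phi>' (\<phi> z) = z" and inv2: "\<phi> (\<phi>' z) = z" and cb: "\<phi> z \<in> cball 0 1" "\<phi>' z \<in> cball 0 1"
    if "z \<in> cball 0 1" for z
    using that inj img inv_into_into[of z \<phi> "cball 0 1"]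
    by (auto simp: \<phi>'_def f_inv_into_f)
  have inv_eq: "inv_into (ball 0 1) \<phi> z = \<phi>' z" if z: "z \<in> ball 0 1" for z
  proof -
    have "z \<in> \<phi> ` ball 0 1" using bij z by (simp add: bij_betw_def)
    then obtain y where y: "y \<in> ball 0 1" "z = \<phi> y" by blast
    then have "\<phi>' z = y" using inv1[of y] by simp
    moreover have "inv_into (ball 0 1) \<phi> z = y"
      using y bij by (simp add: bij_betw_inv_into_left)
    ultimately show ?thesis by simp
  qed
  have "continuous_on (\<phi> ` cball 0 1) \<phi>'"
    using cont inv1 by (intro continuous_on_inv) auto
  then have cont': "continuous_on (cball 0 1) \<phi>'" using img by simp
  have "north_south \<phi> \<phi>' s1 s2"
  proof
    show "\<phi> z \<in> ball 0 1" if "z \<in> ball 0 1" for z using bij that by (rule bij_betwE[rule_format])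
    show "\<phi>' z \<in> ball 0 1" if "z \<in> ball 0 1" for z
      using bij that inv_into_into[of z \<phi> "ball 0 1"] by (simp add: bij_betw_def flip: inv_eq)
    show "\<phi>' holomorphic_on ball 0 1"
      using holi by (rule holomorphic_transform) (rule inv_eq)
    show "(\<lambda>n. (\<phi> ^^ n) z) \<longlonglongrightarrow> s1" if "z \<in> cball 0 1" "z \<noteq> s2" for z
    proof (rule moebius_orbit_tendsto[where S = "cball 0 1", OF _ \<kappa> ne that])
      fix z :: complex assume z: "z \<in> cball 0 1" "z \<noteq> s2"
      then have "\<phi> z \<noteq> s2" using inj s2 s2c by (metis inj_onD)
      then show "\<phi> z \<in> cball 0 1 \<and> \<phi> z \<noteq> s2 \<and> (\<phi> z - s1) * (z - s2) = \<kappa> * (\<phi> z - s2) * (z - s1)"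
        using z cb(1) \<kappa>eq by blast
    qed
    show "(\<lambda>n. (\<phi>' ^^ n) z) \<longlonglongrightarrow> s2" if "z \<in> cball 0 1" "z \<noteq> s1" for z
    proof (rule moebius_orbit_tendsto[where S = "cball 0 1", OF _ \<kappa> ne[symmetric] that])
      fix z :: complex assume z: "z \<in> cball 0 1" "z \<noteq> s1"
      then have "\<phi>' z \<noteq> s1" using s1 inv2 by metis
      moreover have "(\<phi>' z - s2) * (z - s1) = \<kappa> * (\<phi>' z - s1) * (z - s2)"
        using \<kappa>eq[OF cb(2)[OF z(1)]] inv2[OF z(1)] by (simp add: mult_ac)
      ultimately show "\<phi>' z \<in> cball 0 1 \<and> \<phi>' z \<noteq> s1 \<and> (\<phi>' z - s2) * (z - s1) = \<kappa> * (\<phi>' z - s1) * (z - s2)"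
        using z cb(2) by blast
    qed
  qed (use s1 s2 ne cb inv1 inv2 cont cont' hol in auto)
  then show thesis by (rule that)
qed

context north_south
begin

lemma s_cball: "s1 \<in> cball 0 1" "s2 \<in> cball 0 1"
  using attracting repelling by auto

lemma inverse_fixed: "\<phi>' s1 = s1" "\<phi>' s2 = s2"
  using inverse(1)[OF s_cball(1)] inverse(1)[OF s_cball(2)] attracting(2) repelling(2) by auto

lemma iterate_cball: "z \<in> cball 0 1 \<Longrightarrow> (\<phi> ^^ n) z \<in> cball 0 1" "z \<in> cball 0 1 \<Longrightarrow> (\<phi>' ^^ n) z \<in> cball 0 1"
  by (induction n) (use cball in \<open>simp_all del: mem_cball\<close>)

lemma iterate_fixed: "(\<phi> ^^ n) s1 = s1" "(\<phi> ^^ n) s2 = s2" "(\<phi>' ^^ n) s1 = s1" "(\<phi>' ^^ n) s2 = s2"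
  by (induction n) (simp_all add: attracting repelling inverse_fixed)

definition forward_limit where "forward_limit z = (if z = s2 then s2 else s1)"

definition backward_limit where "backward_limit z = (if z = s1 then s1 else s2)"

lemma tendsto_forward_limit: "z \<in> cball 0 1 \<Longrightarrow> (\<lambda>n. (\<phi> ^^ n) z) \<longlonglongrightarrow> forward_limit z"
  using forward by (simp add: forward_limit_def iterate_fixed)

lemma tendsto_backward_limit: "z \<in> cball 0 1 \<Longrightarrow> (\<lambda>n. (\<phi>' ^^ n) z) \<longlonglongrightarrow> backward_limit z"
  using backward by (simp add: backward_limit_def iterate_fixed)

text \<open>A periodic orbit cannot converge to \<open>s1\<close> unless it is constant.\<close>
lemma no_periodic_points:
  assumes z: "z \<in> cball 0 1" "z \<noteq> s1" "z \<noteq> s2" and eq: "(\<phi> ^^ m) z = (\<phi> ^^ n) z"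
  shows "m = n"
proof -
  have inj: "(\<phi>' ^^ k) ((\<phi> ^^ k) u) = u" if "u \<in> cball 0 1" for k u
    using that
  proof (induction k arbitrary: u)
    case (Suc k)
    then show ?case using cball(1)[of u] inverse(1)[of u] by (simp add: funpow_swap1 del: mem_cball)
  qed simp
  have per: "k = 0" if "(\<phi> ^^ k) z = z" for k
  proof (rule ccontr)
    assume "k \<noteq> 0"
    then have "strict_mono (\<lambda>j. k * j)" by (simp add: strict_mono_def)
    then have "(\<lambda>j. (\<phi> ^^ (k * j)) z) \<longlonglongrightarrow> s1"
      using LIMSEQ_subseq_LIMSEQ[OF forward[OF z(1,3)]] by (simp add: o_def)
    moreover have "(\<phi> ^^ (k * j)) z = z" for j
      by (induction j) (use that in \<open>simp_all add: funpow_add\<close>)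
    ultimately show False using z(2) by (simp add: LIMSEQ_const_iff)
  qed
  have *: "i = j" if le: "i \<le> j" and e: "(\<phi> ^^ i) z = (\<phi> ^^ j) z" for i j
  proof -
    have "(\<phi> ^^ j) z = (\<phi> ^^ i) ((\<phi> ^^ (j - i)) z)"
      using le by (simp flip: funpow_add[THEN fun_cong, unfolded o_def])
    then have "(\<phi> ^^ (j - i)) z = z"
      using e inj[OF z(1), of i] inj[OF iterate_cball(1)[OF z(1)], of i "j - i"] by metis
    then show "i = j" using per le by fastforce
  qed
  show ?thesis using *[of m n] *[of n m] eq by (cases "m \<le> n") auto
qed

end

section \<open>Lower bounds for weighted composition operators\<close>

text \<open>Ratio test.\<close>
lemma tendsto_prod_0:
  fixes x :: "nat \<Rightarrow> real"
  assumes "x \<longlonglongrightarrow> L" "L < 1" "\<And>k. 0 \<le> x k"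
  shows "(\<lambda>n. \<Prod>k<n. x k) \<longlonglongrightarrow> 0"
proof -
  obtain c where c: "L < c" "c < 1" using dense assms(2) by blast
  obtain N where N: "\<And>n. n \<ge> N \<Longrightarrow> x n < c"
    using order_tendstoD(2)[OF assms(1) c(1)] by (auto simp: eventually_sequentially)
  have "summable (\<lambda>n. \<Prod>k<n. x k)"
  proof (rule summable_ratio_test[OF c(2)])
    fix n assume "n \<ge> N"
    then have "x n * (\<Prod>k<n. x k) \<le> c * (\<Prod>k<n. x k)"
      using N[of n] assms(3) by (intro mult_right_mono prod_nonneg) auto
    then show "norm (\<Prod>k<Suc n. x k) \<le> c * norm (\<Prod>k<n. x k)"
      using assms(3) by (simp add: abs_mult prod_nonneg mult.commute)
  qed
  then show ?thesis by (rule summable_LIMSEQ_zero)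
qed

lemma continuous_on_iterate:
  assumes "continuous_on S f" "f ` S \<subseteq> S"
  shows "continuous_on S (f ^^ n) \<and> (f ^^ n) ` S \<subseteq> S"
proof (induction n)
  case (Suc n)
  then show ?case
    using assms continuous_on_subset[OF assms(1), of "(f ^^ n) ` S"]
      continuous_on_compose[of S "f ^^ n" f] by (auto simp: o_def)
qed (auto simp: id_def)

text \<open>An approximate solution of \<open>l f = T f\<close> is an approximate solution of \<open>l\<^sup>n f = T\<^sup>n f\<close>.\<close>
lemma pencil_power_bound:
  fixes T :: "'a::complex_banach \<Rightarrow> 'a"
  assumes T: "bounded_clinear T"
  shows "\<exists>C\<ge>0. \<forall>f. norm (l ^ n *\<^sub>C f - (T ^^ n) f) \<le> C * norm (pencil T l f)"
proof (induction n)
  case 0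
  then show ?case by (intro exI[of _ 0]) (simp add: cscale_one)
next
  case (Suc n)
  then obtain C where C: "C \<ge> 0" "\<And>f. norm (l ^ n *\<^sub>C f - (T ^^ n) f) \<le> C * norm (pencil T l f)" by blast
  interpret bounded_linear T using T by (simp add: bounded_clinear_def)
  obtain K where K: "K > 0" "\<And>f. norm (T f) \<le> norm f * K" using pos_bounded by blast
  have "norm (l ^ Suc n *\<^sub>C f - (T ^^ Suc n) f) \<le> (norm l ^ n + K * C) * norm (pencil T l f)" for f
  proof -
    have "l ^ Suc n *\<^sub>C f - (T ^^ Suc n) f = l ^ n *\<^sub>C pencil T l f + T (l ^ n *\<^sub>C f - (T ^^ n) f)"
      using T by (simp add: bounded_clinear_def pencil_def diff cvec.scale_right_diff_distrib cscale_cscale mult.commute)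
    also have "norm \<dots> \<le> norm l ^ n * norm (pencil T l f) + norm (l ^ n *\<^sub>C f - (T ^^ n) f) * K"
      by (intro order_trans[OF norm_triangle_ineq] add_mono K) (simp add: norm_cscale norm_power)
    also have "\<dots> \<le> norm l ^ n * norm (pencil T l f) + (C * norm (pencil T l f)) * K"
      using C(2)[of f] K(1) by (intro add_left_mono mult_right_mono) auto
    finally show ?thesis by (simp add: algebra_simps)
  qed
  moreover have "norm l ^ n + K * C \<ge> 0" using K C by simp
  ultimately show ?case by blast
qed

lemma ev_cscale [simp]: "ev (c *\<^sub>C f) p = c * ev f p"
  by (simp add: cscale_bidisc_algebra_def)

lemma ev_scaleR [simp]: "ev (c *\<^sub>R f) p = complex_of_real c * ev f p"
  by (simp add: scaleR_bidisc_algebra_def)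

lemma continuous_on_ev: "continuous_on bidisc (ev f)"
  by (rule bidisc_alg_setD(1)[OF ev])

lemma norm_attained:
  obtains p where "p \<in> bidisc" "norm (ev f p) = norm f"
proof -
  have "bidisc \<noteq> {}" by auto
  then obtain p where p: "p \<in> bidisc" "\<And>q. q \<in> bidisc \<Longrightarrow> norm (ev f q) \<le> norm (ev f p)"
    using continuous_attains_sup[OF compact_bidisc _ continuous_on_norm[OF continuous_on_ev[of f]]] by metis
  have "norm f \<le> norm (ev f p)" by (rule norm_bidisc_algebra_le) (rule p(2))
  then show thesis using that[OF p(1)] norm_ev_le[of f p] by simp
qed

text \<open>A lower bound for \<open>A f\<close> may be tested at a point where \<open>f\<close> attains its norm, with a constant that depends
  on the point.  If no uniform constant existed, points of maximum for worse and worse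
  functions would accumulate at some \<open>p\<close>, contradicting the estimate with weight \<open>G\<close> that is positive at \<open>p\<close>.\<close>
lemma bounded_below_compactness:
  fixes A :: "bidisc_algebra \<Rightarrow> bidisc_algebra"
  assumes local: "\<And>p. p \<in> bidisc \<Longrightarrow> \<exists>(G :: complex \<times> complex \<Rightarrow> real) C. continuous_on bidisc G \<and> 0 < G p \<and>
      (\<forall>f. \<forall>q\<in>bidisc. norm (ev f q) = norm f \<longrightarrow> G q * norm f \<le> C * norm (A f))"
  shows "bounded_below A"
proof (rule ccontr)
  assume "\<not> bounded_below A"
  then have "\<exists>f. norm (A f) < 1 / real (Suc j) * norm f" for j
    unfolding bounded_below_def not_ex not_all de_Morgan_conj not_le
    by (metis of_nat_0_less_iff zero_less_Suc zero_less_divide_1_iff)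
  then obtain f where f: "\<And>j. norm (A (f j)) < 1 / real (Suc j) * norm (f j)" by metis
  have "\<exists>q\<in>bidisc. norm (ev (f j) q) = norm (f j)" for j using norm_attained by metis
  then obtain q where q: "\<And>j. q j \<in> bidisc" "\<And>j. norm (ev (f j) (q j)) = norm (f j)" by metis
  obtain p and \<rho> :: "nat \<Rightarrow> nat" where p: "p \<in> bidisc" "strict_mono \<rho>" "(q \<circ> \<rho>) \<longlonglongrightarrow> p"
    using compact_bidisc[unfolded compact_def, rule_format, of q] q(1) by blast
  obtain G C where G: "continuous_on bidisc G" "0 < G p"
    "\<And>f q. q \<in> bidisc \<Longrightarrow> norm (ev f q) = norm f \<Longrightarrow> G q * norm f \<le> C * norm (A f)"
    using local[OF p(1)] by metis
  have le: "G (q j) \<le> \<bar>C\<bar> * (1 / real (Suc j))" for j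
  proof -
    have "norm (f j) > 0"
      using f[of j] norm_ge_zero[of "A (f j)"] by (cases "f j = 0") auto
    moreover have "G (q j) * norm (f j) \<le> \<bar>C\<bar> * (1 / real (Suc j)) * norm (f j)"
    proof -
      have "G (q j) * norm (f j) \<le> C * norm (A (f j))" by (rule G(3)[OF q])
      also have "\<dots> \<le> \<bar>C\<bar> * norm (A (f j))" by (intro mult_right_mono) auto
      also have "\<dots> \<le> \<bar>C\<bar> * (1 / real (Suc j) * norm (f j))"
        using f[of j] by (intro mult_left_mono) auto
      finally show ?thesis by simp
    qed
    ultimately show ?thesis by (rule mult_right_le_imp_le[rotated])
  qed
  have "(\<lambda>j. G (q (\<rho> j))) \<longlonglongrightarrow> G p"
    using continuous_on_tendsto_compose[OF G(1) p(3) p(1)] q(1) by (simp add: o_def)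
  moreover have "(\<lambda>j. \<bar>C\<bar> * (1 / real (Suc (\<rho> j)))) \<longlonglongrightarrow> \<bar>C\<bar> * 0"
    using LIMSEQ_subseq_LIMSEQ[OF LIMSEQ_inverse_real_of_nat p(2)]
    by (intro tendsto_mult_left) (simp add: o_def inverse_eq_divide)
  ultimately have "G p \<le> \<bar>C\<bar> * 0"
    by (rule LIMSEQ_le) (use le in blast)
  then show False using G(2) by simp
qed

locale weighted_composition =
  S: north_south \<phi> \<phi>' s1 s2 + R: north_south \<psi> \<psi>' t1 t2
  for \<phi> \<phi>' s1 s2 \<psi> \<psi>' t1 t2 +
  fixes w :: bidisc_algebra and T :: "bidisc_algebra \<Rightarrow> bidisc_algebra"
  assumes T_eq: "p \<in> bidisc \<Longrightarrow> ev (T f) p = ev w p * ev f (\<phi> (fst p), \<psi> (snd p))"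
    and w_unit: "w dvd 1"
begin

definition \<Phi> where "\<Phi> p = (\<phi> (fst p), \<psi> (snd p))"
definition \<Phi>' where "\<Phi>' p = (\<phi>' (fst p), \<psi>' (snd p))"

text \<open>The cocycle with \<open>T\<^sup>n f = W n * (f \<circ> \<Phi>\<^sup>n)\<close>.\<close>
definition W where "W n p = (\<Prod>k<n. ev w ((\<Phi> ^^ k) p))"

lemma \<Phi>_iterate: "(\<Phi> ^^ n) p = ((\<phi> ^^ n) (fst p), (\<psi> ^^ n) (snd p))"
  and \<Phi>'_iterate: "(\<Phi>' ^^ n) p = ((\<phi>' ^^ n) (fst p), (\<psi>' ^^ n) (snd p))"
  by (induction n) (simp_all add: \<Phi>_def \<Phi>'_def)

lemma iterate_bidisc [intro]: "p \<in> bidisc \<Longrightarrow> (\<Phi> ^^ n) p \<in> bidisc" "p \<in> bidisc \<Longrightarrow> (\<Phi>' ^^ n) p \<in> bidisc"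
  unfolding \<Phi>_iterate \<Phi>'_iterate using S.iterate_cball R.iterate_cball by (auto simp del: mem_cball)

lemma \<Phi>_bidisc [intro]: "p \<in> bidisc \<Longrightarrow> \<Phi> p \<in> bidisc" "p \<in> bidisc \<Longrightarrow> \<Phi>' p \<in> bidisc"
  using iterate_bidisc[of p 1] by auto

lemma \<Phi>_inverse: "p \<in> bidisc \<Longrightarrow> \<Phi>' (\<Phi> p) = p" "p \<in> bidisc \<Longrightarrow> \<Phi> (\<Phi>' p) = p"
  unfolding \<Phi>_def \<Phi>'_def using S.inverse R.inverse by (auto simp del: mem_cball)

lemma iterate_inverse: "p \<in> bidisc \<Longrightarrow> (\<Phi>' ^^ n) ((\<Phi> ^^ n) p) = p" "p \<in> bidisc \<Longrightarrow> (\<Phi> ^^ n) ((\<Phi>' ^^ n) p) = p"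
proof (induction n arbitrary: p)
  case (Suc n)
  { case 1
    then have "(\<Phi>' ^^ Suc n) ((\<Phi> ^^ Suc n) p) = \<Phi>' ((\<Phi>' ^^ n) ((\<Phi> ^^ n) (\<Phi> p)))"
      by (simp add: funpow_swap1)
    then show ?case using Suc(1)[OF \<Phi>_bidisc(1)[OF 1]] \<Phi>_inverse(1)[OF 1] by simp
  next
    case 2
    then have "(\<Phi> ^^ Suc n) ((\<Phi>' ^^ Suc n) p) = \<Phi> ((\<Phi> ^^ n) ((\<Phi>' ^^ n) (\<Phi>' p)))"
      by (simp add: funpow_swap1)
    then show ?case using Suc(2)[OF \<Phi>_bidisc(2)[OF 2]] \<Phi>_inverse(2)[OF 2] by simp }
qed auto

lemma continuous_on_\<Phi>: "continuous_on bidisc \<Phi>" "continuous_on bidisc \<Phi>'"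
  unfolding \<Phi>_def \<Phi>'_def
  by (intro continuous_on_Pair continuous_on_compose2[OF S.continuous(1)] continuous_on_compose2[OF R.continuous(1)]
      continuous_on_compose2[OF S.continuous(2)] continuous_on_compose2[OF R.continuous(2)] continuous_intros; force)+

lemma continuous_on_iterate_\<Phi>: "continuous_on bidisc (\<Phi> ^^ n)" "continuous_on bidisc (\<Phi>' ^^ n)"
  using continuous_on_iterate[OF continuous_on_\<Phi>(1), of n] continuous_on_iterate[OF continuous_on_\<Phi>(2), of n] \<Phi>_bidisc
  by blast+

lemma continuous_on_ev_iterate: "continuous_on bidisc (\<lambda>p. ev f ((\<Phi> ^^ n) p))"
  by (rule continuous_on_compose2[OF continuous_on_ev continuous_on_iterate_\<Phi>(1)]) (use iterate_bidisc in blast)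

lemma continuous_on_W: "continuous_on bidisc (W n)"
  unfolding W_def by (intro continuous_intros continuous_on_ev_iterate)

lemma w_nonzero: "p \<in> bidisc \<Longrightarrow> ev w p \<noteq> 0"
proof -
  assume p: "p \<in> bidisc"
  obtain v where "1 = w * v" using w_unit by (auto simp: dvd_def)
  then have "ev w p * ev v p = ev 1 p" by (metis times_bidisc_algebra.rep_eq)
  then show ?thesis using p by (auto simp: one_bidisc_algebra.rep_eq)
qed

lemma W_nonzero: "p \<in> bidisc \<Longrightarrow> W n p \<noteq> 0"
  unfolding W_def using w_nonzero iterate_bidisc by (simp del: mem_Times_iff)

lemma W_add: "W (m + n) p = W m p * W n ((\<Phi> ^^ m) p)"
  by (induction n) (simp_all add: W_def funpow_add[of _ m, THEN fun_cong, unfolded o_def, symmetric] add.commute)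

lemma W_0 [simp]: "W 0 p = 1" by (simp add: W_def)
lemma W_Suc: "W (Suc n) p = W n p * ev w ((\<Phi> ^^ n) p)" by (simp add: W_def)
lemma W_Suc': "W (Suc n) p = ev w p * W n (\<Phi> p)"
  using W_add[of 1 n p] by (simp add: W_def)

lemma W_backward:
  assumes "p \<in> bidisc"
  shows "W n ((\<Phi>' ^^ n) p) = (\<Prod>k<n. ev w ((\<Phi>' ^^ Suc k) p))"
proof (induction n)
  case (Suc n)
  have "W (Suc n) ((\<Phi>' ^^ Suc n) p) = ev w ((\<Phi>' ^^ Suc n) p) * W n (\<Phi> (\<Phi>' ((\<Phi>' ^^ n) p)))"
    by (simp add: W_Suc')
  then show ?case using Suc \<Phi>_inverse(2)[OF iterate_bidisc(2)[OF assms]] by (simp add: mult.commute)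
qed simp

lemma T_power: "p \<in> bidisc \<Longrightarrow> ev ((T ^^ n) f) p = W n p * ev f ((\<Phi> ^^ n) p)"
proof (induction n arbitrary: p)
  case (Suc n)
  then show ?case
    using Suc.IH[OF \<Phi>_bidisc(1)[OF Suc.prems]]
    by (simp add: T_eq W_Suc' funpow_swap1[of \<Phi>] flip: \<Phi>_def)
qed simp

lemma bounded_clinear_T: "bounded_clinear T"
  unfolding bounded_clinear_def
proof (intro conjI allI)
  show "bounded_linear T"
  proof (rule bounded_linear_intro[where K = "norm w"])
    show "T (f + g) = T f + T g" for f g
      by (rule bidisc_algebra_eqI) (simp add: T_eq algebra_simps del: mem_Times_iff)
    show "T (c *\<^sub>R f) = c *\<^sub>R T f" for c f
      by (rule bidisc_algebra_eqI) (simp add: T_eq algebra_simps del: mem_Times_iff)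
    show "norm (T f) \<le> norm f * norm w" for f
    proof (rule norm_bidisc_algebra_le)
      show "norm (ev (T f) p) \<le> norm f * norm w" if "p \<in> bidisc" for p
        unfolding T_eq[OF that] norm_mult mult.commute[of "norm f"] by (intro mult_mono norm_ev_le) auto
    qed
  qed
  show "T (c *\<^sub>C f) = c *\<^sub>C T f" for c f
    by (rule bidisc_algebra_eqI) (simp add: T_eq algebra_simps del: mem_Times_iff)
qed

text \<open>With \<open>v\<close> the inverse of \<open>w\<close>, a preimage of \<open>g\<close> is \<open>(v g) \<circ> \<Phi>'\<close>.\<close>
lemma surj_T: "surj T"
proof -
  have "\<exists>f. T f = g" for g
  proof -
    obtain v where v: "1 = w * v" using w_unit by (auto simp: dvd_def)
    define F where "F p = (if p \<in> bidisc then ev (v * g) (\<Phi>' p) else 0)" for p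
    have "F \<in> bidisc_alg_set"
    proof (rule bidisc_alg_setI)
      show "continuous_on bidisc (\<lambda>p. ev (v * g) (\<Phi>' p))"
        by (rule continuous_on_compose2[OF continuous_on_ev continuous_on_\<Phi>(2)]) (use \<Phi>_bidisc in blast)
      show "(\<lambda>z. ev (v * g) (\<Phi>' (z, b))) holomorphic_on ball 0 1" if "norm b < 1" for b
      proof -
        have "norm (\<psi>' b) < 1" using R.ball(2)[of b] that by simp
        then have "(\<lambda>z. ev (v * g) (z, \<psi>' b)) \<circ> \<phi>' holomorphic_on ball 0 1"
          using S.ball(2) by (intro holomorphic_on_compose_gen[OF S.holomorphic(2) bidisc_alg_setD(2)[OF ev]]) auto
        then show ?thesis by (simp add: o_def \<Phi>'_def)
      qed
      show "(\<lambda>z. ev (v * g) (\<Phi>' (a, z))) holomorphic_on ball 0 1" if "norm a < 1" for a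
      proof -
        have "norm (\<phi>' a) < 1" using S.ball(2)[of a] that by simp
        then have "(\<lambda>z. ev (v * g) (\<phi>' a, z)) \<circ> \<psi>' holomorphic_on ball 0 1"
          using R.ball(2) by (intro holomorphic_on_compose_gen[OF R.holomorphic(2) bidisc_alg_setD(3)[OF ev]]) auto
        then show ?thesis by (simp add: o_def \<Phi>'_def)
      qed
    qed (auto simp: F_def)
    then have F: "ev (Abs_bidisc_algebra F) = F" by (rule Abs_bidisc_algebra_inverse)
    have "T (Abs_bidisc_algebra F) = g"
    proof (rule bidisc_algebra_eqI)
      fix p :: "complex \<times> complex" assume p: "p \<in> bidisc"
      have "ev w p * ev v p = ev 1 p" by (metis v times_bidisc_algebra.rep_eq)
      then have wv: "ev w p * ev v p = 1" using p by (simp add: one_bidisc_algebra.rep_eq)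
      have "ev (T (Abs_bidisc_algebra F)) p = ev w p * F (\<Phi> p)"
        using p by (simp add: T_eq F \<Phi>_def del: mem_Times_iff)
      also have "\<dots> = ev w p * ev v p * ev g p"
        using \<Phi>_bidisc(1)[OF p] \<Phi>_inverse(1)[OF p] by (simp add: F_def mult.assoc del: mem_Times_iff)
      finally show "ev (T (Abs_bidisc_algebra F)) p = ev g p" by (simp add: wv)
    qed
    then show ?thesis ..
  qed
  then show ?thesis by (metis surjI)
qed

definition forward_weight where
  "forward_weight p = norm (ev w (S.forward_limit (fst p), R.forward_limit (snd p)))"

definition backward_weight where
  "backward_weight p = norm (ev w (S.backward_limit (fst p), R.backward_limit (snd p)))"

lemma forward_tendsto_0:
  assumes p: "p \<in> bidisc" and l: "forward_weight p < norm l"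
  shows "(\<lambda>n. norm (W n p) / norm l ^ n) \<longlonglongrightarrow> 0"
proof -
  let ?P = "(S.forward_limit (fst p), R.forward_limit (snd p))"
  have P: "?P \<in> bidisc"
    using S.s_cball R.s_cball by (simp add: S.forward_limit_def R.forward_limit_def)
  have "(\<lambda>k. (\<Phi> ^^ k) p) \<longlonglongrightarrow> ?P"
    unfolding \<Phi>_iterate using p by (intro tendsto_Pair S.tendsto_forward_limit R.tendsto_forward_limit) auto
  then have "(\<lambda>k. ev w ((\<Phi> ^^ k) p)) \<longlonglongrightarrow> ev w ?P"
    using P iterate_bidisc(1)[OF p] by (intro continuous_on_tendsto_compose[OF continuous_on_ev]) auto
  then have lim: "(\<lambda>k. norm (ev w ((\<Phi> ^^ k) p)) / norm l) \<longlonglongrightarrow> norm (ev w ?P) / norm l"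
    using l unfolding forward_weight_def by (intro tendsto_intros) auto
  have lt: "norm (ev w ?P) / norm l < 1"
    using l le_less_trans[OF norm_ge_zero l[unfolded forward_weight_def]] by (simp add: forward_weight_def)
  show ?thesis
    using tendsto_prod_0[OF lim lt] by (simp add: W_def prod_norm prod_dividef)
qed

lemma backward_tendsto_0:
  assumes p: "p \<in> bidisc" and l: "norm l < backward_weight p"
  shows "(\<lambda>n. norm l ^ n / norm (W n ((\<Phi>' ^^ n) p))) \<longlonglongrightarrow> 0"
proof -
  let ?P = "(S.backward_limit (fst p), R.backward_limit (snd p))"
  have P: "?P \<in> bidisc"
    using S.s_cball R.s_cball by (simp add: S.backward_limit_def R.backward_limit_def)
  have "(\<lambda>k. (\<Phi>' ^^ k) p) \<longlonglongrightarrow> ?P"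
    unfolding \<Phi>'_iterate using p by (intro tendsto_Pair S.tendsto_backward_limit R.tendsto_backward_limit) auto
  then have "(\<lambda>k. (\<Phi>' ^^ Suc k) p) \<longlonglongrightarrow> ?P" by (rule LIMSEQ_Suc)
  then have "(\<lambda>k. ev w ((\<Phi>' ^^ Suc k) p)) \<longlonglongrightarrow> ev w ?P"
    using P iterate_bidisc(2)[OF p] by (intro continuous_on_tendsto_compose[OF continuous_on_ev] always_eventually allI)
  then have lim: "(\<lambda>k. norm l / norm (ev w ((\<Phi>' ^^ Suc k) p))) \<longlonglongrightarrow> norm l / norm (ev w ?P)"
    using w_nonzero[OF P] by (intro tendsto_intros) auto
  have lt: "norm l / norm (ev w ?P) < 1"
    using l w_nonzero[OF P] by (simp add: backward_weight_def)
  show ?thesis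
    using tendsto_prod_0[OF lim lt] by (simp add: W_backward[OF p] prod_norm prod_dividef)
qed

text \<open>Let \<open>l f - T f\<close> be small and let \<open>|f|\<close> attain its maximum at \<open>p\<close>.  Then
  \<open>l\<^sup>n f(p)\<close> is close to \<open>W n p * f (\<Phi>\<^sup>n p)\<close>, which forces \<open>|l|\<^sup>n \<le> |W n p|\<close> approximately; the same
  relation at \<open>\<Phi>\<^sup>-\<^sup>n p\<close> forces \<open>|W n (\<Phi>\<^sup>-\<^sup>n p)| \<le> |l|\<^sup>n\<close> approximately.  For large \<open>n\<close> the first fails if \<open>|l|\<close>
  exceeds the forward weight, the second if \<open>|l|\<close> is below the backward weight.\<close>
lemma bounded_below_pencil:
  assumes "\<And>p. p \<in> bidisc \<Longrightarrow> forward_weight p < norm l \<or> norm l < backward_weight p"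
  shows "bounded_below (pencil T l)"
proof (rule bounded_below_compactness)
  fix p :: "complex \<times> complex" assume p: "p \<in> bidisc"
  have pw: "norm (l ^ n * ev f q - W n q * ev f ((\<Phi> ^^ n) q)) \<le> norm (l ^ n *\<^sub>C f - (T ^^ n) f)"
    if "q \<in> bidisc" for n f q
    using norm_ev_le[of "l ^ n *\<^sub>C f - (T ^^ n) f" q] that by (simp add: T_power del: mem_Times_iff)
  from assms[OF p] show "\<exists>(G :: complex \<times> complex \<Rightarrow> real) C. continuous_on bidisc G \<and> 0 < G p \<and>
      (\<forall>f. \<forall>q\<in>bidisc. norm (ev f q) = norm f \<longrightarrow> G q * norm f \<le> C * norm (pencil T l f))"
  proof
    assume l: "forward_weight p < norm l"
    have "0 \<le> forward_weight p" by (simp add: forward_weight_def)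
    then have l0: "norm l > 0" using l by linarith
    obtain n where n: "norm (W n p) / norm l ^ n < 1"
      using order_tendstoD(2)[OF forward_tendsto_0[OF p l], of 1] by (auto simp: eventually_sequentially)
    obtain C where C: "\<And>f. norm (l ^ n *\<^sub>C f - (T ^^ n) f) \<le> C * norm (pencil T l f)"
      using pencil_power_bound[OF bounded_clinear_T] by blast
    define G where "G q = norm l ^ n - norm (W n q)" for q
    have "G q * norm f \<le> C * norm (pencil T l f)" if q: "q \<in> bidisc" "norm (ev f q) = norm f" for f q
    proof -
      have "G q * norm f = norm (l ^ n * ev f q) - norm (W n q) * norm f"
        using q(2) by (simp add: G_def norm_mult norm_power algebra_simps)
      also have "\<dots> \<le> norm (l ^ n * ev f q) - norm (W n q * ev f ((\<Phi> ^^ n) q))"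
        unfolding norm_mult[of "W n q"] by (intro diff_left_mono mult_left_mono norm_ev_le) auto
      also have "\<dots> \<le> C * norm (pencil T l f)"
        using norm_triangle_ineq2 pw[OF q(1), of n f] C[of f] by (meson order_trans)
      finally show ?thesis .
    qed
    moreover have "continuous_on bidisc G"
      unfolding G_def by (intro continuous_intros continuous_on_W)
    moreover have "0 < G p" using n l0 by (simp add: G_def)
    ultimately show ?thesis by blast
  next
    assume l: "norm l < backward_weight p"
    obtain n where n: "norm l ^ n / norm (W n ((\<Phi>' ^^ n) p)) < 1"
      using order_tendstoD(2)[OF backward_tendsto_0[OF p l], of 1] by (auto simp: eventually_sequentially)
    obtain C where C: "\<And>f. norm (l ^ n *\<^sub>C f - (T ^^ n) f) \<le> C * norm (pencil T l f)"
      using pencil_power_bound[OF bounded_clinear_T] by blast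
    define G where "G q = norm (W n ((\<Phi>' ^^ n) q)) - norm l ^ n" for q
    have "G q * norm f \<le> C * norm (pencil T l f)" if q: "q \<in> bidisc" "norm (ev f q) = norm f" for f q
    proof -
      let ?u = "(\<Phi>' ^^ n) q"
      have u: "?u \<in> bidisc" "(\<Phi> ^^ n) ?u = q" by (rule iterate_bidisc(2)[OF q(1)], rule iterate_inverse(2)[OF q(1)])
      have "G q * norm f = norm (W n ?u * ev f ((\<Phi> ^^ n) ?u)) - norm (l ^ n) * norm f"
        using q(2) by (simp add: G_def u(2) norm_mult norm_power algebra_simps)
      also have "\<dots> \<le> norm (W n ?u * ev f ((\<Phi> ^^ n) ?u)) - norm (l ^ n * ev f ?u)"
        unfolding norm_mult[of "l ^ n"] by (intro diff_left_mono mult_left_mono norm_ev_le) auto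
      also have "\<dots> \<le> norm (l ^ n * ev f ?u - W n ?u * ev f ((\<Phi> ^^ n) ?u))"
        by (subst norm_minus_commute) (rule norm_triangle_ineq2)
      also have "\<dots> \<le> C * norm (pencil T l f)"
        using pw[OF u(1), of n f] C[of f] by linarith
      finally show ?thesis .
    qed
    moreover have "continuous_on bidisc G"
      unfolding G_def
      by (intro continuous_intros continuous_on_compose2[OF continuous_on_W continuous_on_iterate_\<Phi>(2)])
        (use iterate_bidisc in blast)
    moreover have "0 < G p" using n W_nonzero[OF iterate_bidisc(2)[OF p]] by (simp add: G_def)
    ultimately show ?thesis by blast
  qed
qed

text \<open>Surjectivity spreads from \<open>l = 0\<close>.\<close>
lemma surj_pencil_inside:
  assumes bb: "\<And>m. norm m < \<rho> \<Longrightarrow> bounded_below (pencil T m)" and l: "norm l < \<rho>"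
  shows "surj (pencil T l)"
proof (rule surj_pencil_connected[OF bounded_clinear_T, where S = "ball 0 \<rho>" and ?l0.0 = 0])
  interpret bounded_linear T using bounded_clinear_T by (simp add: bounded_clinear_def)
  show "surj (pencil T 0)"
  proof (rule surjI)
    show "pencil T 0 (inv T (- f)) = f" for f
      using surj_f_inv_f[OF surj_T] by (simp add: pencil_def)
  qed
  show "0 \<in> ball 0 \<rho>" using l le_less_trans[OF norm_ge_zero l] by simp
qed (use assms in auto)

text \<open>Surjectivity spreads from a point \<open>l0\<close> with \<open>|l0| > \<parallel>T\<parallel>\<close>, where \<open>l0 - T\<close> is a small perturbation of \<open>l0\<close>.\<close>
lemma surj_pencil_outside:
  assumes bb: "\<And>m. \<rho> < norm m \<Longrightarrow> bounded_below (pencil T m)" and l: "\<rho> < norm l"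
  shows "surj (pencil T l)"
proof -
  have T: "bounded_linear T" using bounded_clinear_T by (simp add: bounded_clinear_def)
  then obtain K where K: "K > 0" "\<And>f. norm (T f) \<le> norm f * K"
    using bounded_linear.pos_bounded by blast
  define l0 where "l0 = complex_of_real (max K \<rho> + 1)"
  have n0: "norm l0 = max K \<rho> + 1" using K by (simp add: l0_def del: of_real_add)
  then have l0: "\<rho> < norm l0" "K < norm l0" "norm l0 > 0" using K by (auto simp: max_def)
  have "surj (pencil T l0)"
  proof (rule surj_perturbation[where \<delta> = "norm l0" and \<eta> = K])
    show "bounded_linear ((*\<^sub>C) l0 :: bidisc_algebra \<Rightarrow> _)" "bounded_linear (pencil T l0)"
      using bounded_clinear_cscale bounded_clinear_pencil[OF bounded_clinear_T] by (auto simp: bounded_clinear_def)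
    show "surj ((*\<^sub>C) l0 :: bidisc_algebra \<Rightarrow> _)"
      by (rule surjI[where f = "\<lambda>f. (1 / l0) *\<^sub>C f"]) (use l0 in \<open>simp add: cscale_cscale cscale_one\<close>)
  qed (use K l0 in \<open>auto simp: norm_cscale pencil_def mult.commute\<close>)
  then show ?thesis
  proof (rule surj_pencil_connected[OF bounded_clinear_T, where S = "- cball 0 \<rho>" and ?l0.0 = l0, rotated -2])
    show "connected (- cball (0::complex) \<rho>)"
      by (intro connected_complement_bounded_convex) auto
  qed (use l0 l bb in auto)
qed

text \<open>All orbits in the open bidisc run from \<open>(s2, t2)\<close> to \<open>(s1, t1)\<close>, so there an eigenfunction vanishes by the growth
  argument in one of the two time directions; the open bidisc is dense.\<close>
lemma kernel_trivial:
  assumes l: "norm l < norm (ev w (s2, t2)) \<or> norm (ev w (s1, t1)) < norm l" and f: "pencil T l f = 0"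
  shows "f = 0"
proof -
  have C: "(T ^^ n) f = l ^ n *\<^sub>C f" for n
  proof -
    obtain C where "norm (l ^ n *\<^sub>C f - (T ^^ n) f) \<le> C * norm (pencil T l f)"
      using pencil_power_bound[OF bounded_clinear_T] by blast
    then show ?thesis by (simp add: f)
  qed
  have eq: "W n p * ev f ((\<Phi> ^^ n) p) = l ^ n * ev f p" if "p \<in> bidisc" for n p
    using T_power[OF that, of n f] by (simp add: C)
  have zero: "ev f p = 0" if p: "p \<in> ball 0 1 \<times> ball 0 1" for p
  proof -
    have pb: "p \<in> bidisc" using p by auto
    have ne: "fst p \<noteq> s1" "fst p \<noteq> s2" "snd p \<noteq> t1" "snd p \<noteq> t2"
      using p S.attracting S.repelling R.attracting R.repelling by auto
    have fw: "forward_weight p = norm (ev w (s1, t1))" and bw: "backward_weight p = norm (ev w (s2, t2))"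
      using ne by (auto simp: forward_weight_def backward_weight_def S.forward_limit_def R.forward_limit_def
          S.backward_limit_def R.backward_limit_def)
    from l have "\<exists>e. e \<longlonglongrightarrow> 0 \<and> (\<forall>n. norm (ev f p) \<le> e n * norm f)"
    proof
      assume *: "norm l < norm (ev w (s2, t2))"
      have "norm (ev f p) \<le> norm l ^ n / norm (W n ((\<Phi>' ^^ n) p)) * norm f" for n
      proof -
        have "norm (W n ((\<Phi>' ^^ n) p)) * norm (ev f p) \<le> norm l ^ n * norm f"
          using arg_cong[OF eq[OF iterate_bidisc(2)[OF pb], of n n], of norm] iterate_inverse(2)[OF pb]
            mult_left_mono[OF norm_ev_le, of "norm l ^ n"] by (simp add: norm_mult norm_power)
        then show ?thesis
          using W_nonzero[OF iterate_bidisc(2)[OF pb], of n n] by (simp add: field_simps)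
      qed
      then show ?thesis using backward_tendsto_0[OF pb] * bw by fastforce
    next
      assume *: "norm (ev w (s1, t1)) < norm l"
      then have l0: "norm l > 0" by (rule le_less_trans[OF norm_ge_zero])
      have "norm (ev f p) \<le> norm (W n p) / norm l ^ n * norm f" for n
      proof -
        have "norm l ^ n * norm (ev f p) \<le> norm (W n p) * norm f"
          using arg_cong[OF eq[OF pb, of n], of norm] mult_left_mono[OF norm_ev_le, of "norm (W n p)"]
          by (metis norm_ge_zero norm_mult norm_power)
        then show ?thesis using l0 by (simp add: field_simps)
      qed
      then show ?thesis using forward_tendsto_0[OF pb] * fw by fastforce
    qed
    then obtain e where e: "e \<longlonglongrightarrow> 0" "\<And>n. norm (ev f p) \<le> e n * norm f" by blast
    have "norm (ev f p) \<le> 0 * norm f"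
      by (rule LIMSEQ_le_const[OF tendsto_mult_right[OF e(1)]]) (use e(2) in blast)
    then show ?thesis by simp
  qed
  show "f = 0"
  proof (rule bidisc_algebra_eqI)
    fix p :: "complex \<times> complex" assume "p \<in> bidisc"
    then have p: "p \<in> closure (ball 0 1 \<times> ball 0 1)" by (simp add: closure_Times)
    have "ev f p = 0"
      by (rule continuous_constant_on_closure[OF _ zero p]) (use continuous_on_ev in \<open>simp_all add: closure_Times\<close>)
    then show "ev f p = ev 0 p" by simp
  qed
qed

end

section \<open>Peak functions\<close>

lemma norm_half_one_plus:
  fixes u :: complex
  assumes "norm u \<le> 1"
  shows "norm ((1 + u) / 2) \<le> 1" and "u \<noteq> 1 \<Longrightarrow> norm ((1 + u) / 2) < 1"
proof -
  show le: "norm ((1 + u) / 2) \<le> 1"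
    using norm_triangle_ineq[of 1 u] assms by (simp add: norm_divide)
  show "norm ((1 + u) / 2) < 1" if "u \<noteq> 1"
  proof (rule ccontr)
    assume "\<not> norm ((1 + u) / 2) < 1"
    then have "norm (1 + u) = 2" using le by (simp add: norm_divide)
    then have "norm (1 + u) = norm (1 :: complex) + norm u"
      using norm_triangle_ineq[of 1 u] assms by simp
    then have "norm (1 :: complex) *\<^sub>R u = norm u *\<^sub>R 1" by (rule norm_triangle_eq[THEN iffD1])
    moreover have "norm u = 1"
      using \<open>norm (1 + u) = 2\<close> norm_triangle_ineq[of 1 u] assms by simp
    ultimately show False using that by simp
  qed
qed

lemma peak_function:
  assumes q: "q \<in> sphere 0 1 \<times> sphere 0 1"
  obtains h where "ev h q = 1" "norm h \<le> 1" "\<And>p. p \<in> bidisc \<Longrightarrow> p \<noteq> q \<Longrightarrow> norm (ev h p) < 1"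
proof -
  define g :: "complex \<times> complex \<Rightarrow> complex"
    where "g p = (1 + cnj (fst q) * fst p) / 2 * ((1 + cnj (snd q) * snd p) / 2)" for p
  define F where "F p = (if p \<in> bidisc then g p else 0)" for p
  have "F \<in> bidisc_alg_set"
    by (rule bidisc_alg_setI[where g = g])
      (auto simp: F_def g_def intro!: continuous_intros holomorphic_intros)
  then have F: "ev (Abs_bidisc_algebra F) = F" by (rule Abs_bidisc_algebra_inverse)
  have unit: "cnj a * a = 1" if "norm a = 1" for a :: complex
    using that complex_norm_square[of a] by (simp add: mult.commute)
  have n1: "norm (fst q) = 1" and n2: "norm (snd q) = 1" using q by auto
  have qb: "q \<in> bidisc" using n1 n2 by (simp add: mem_Times_iff)
  have ne: "cnj a * z \<noteq> 1" if "norm a = 1" "z \<noteq> a" for a z :: complex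
  proof
    assume "cnj a * z = 1"
    then have "cnj a * (z - a) = 0" using unit[OF that(1)] by (simp add: algebra_simps)
    then show False using that by auto
  qed
  have le: "norm (g p) \<le> 1" and lt: "p \<noteq> q \<Longrightarrow> norm (g p) < 1" if p: "p \<in> bidisc" for p
  proof -
    have a: "norm (cnj (fst q) * fst p) \<le> 1" "norm (cnj (snd q) * snd p) \<le> 1"
      using p n1 n2 by (auto simp: norm_mult mem_Times_iff)
    note l = norm_half_one_plus(1)[OF a(1)] norm_half_one_plus(1)[OF a(2)]
    show "norm (g p) \<le> 1"
      unfolding g_def norm_mult by (rule mult_le_one[OF l(1) norm_ge_zero l(2)])
    assume "p \<noteq> q"
    then consider "fst p \<noteq> fst q" | "snd p \<noteq> snd q" by (auto simp: prod_eq_iff)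
    then show "norm (g p) < 1"
    proof cases
      case 1
      have "norm ((1 + cnj (fst q) * fst p) / 2) < 1"
        by (rule norm_half_one_plus(2)[OF a(1) ne[OF n1 1]])
      then show ?thesis unfolding g_def norm_mult using l(2) mult_left_le[OF l(2) norm_ge_zero]
        by (meson le_less_trans)
    next
      case 2
      have "norm ((1 + cnj (snd q) * snd p) / 2) < 1"
        by (rule norm_half_one_plus(2)[OF a(2) ne[OF n2 2]])
      then show ?thesis unfolding g_def norm_mult using mult_right_le_one_le[OF norm_ge_zero norm_ge_zero l(1)]
        by (metis le_less_trans mult.commute)
    qed
  qed
  show thesis
  proof
    show "ev (Abs_bidisc_algebra F) q = 1"
      using qb unit[OF n1] unit[OF n2] by (simp add: F F_def g_def)
    show "norm (Abs_bidisc_algebra F) \<le> 1"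
      by (rule norm_bidisc_algebra_le) (use le in \<open>simp add: F F_def del: mem_Times_iff\<close>)
    show "norm (ev (Abs_bidisc_algebra F) p) < 1" if "p \<in> bidisc" "p \<noteq> q" for p
      using lt that by (simp add: F F_def del: mem_Times_iff)
  qed
qed

lemma ev_power: "p \<in> bidisc \<Longrightarrow> ev (h ^ m) p = ev h p ^ m"
  by (induction m) (simp_all add: one_bidisc_algebra.rep_eq del: mem_Times_iff)

lemma norm_power_le_1:
  fixes h :: bidisc_algebra
  assumes "norm h \<le> 1"
  shows "norm (h ^ m) \<le> 1"
proof (rule norm_bidisc_algebra_le)
  fix p :: "complex \<times> complex" assume "p \<in> bidisc"
  then show "norm (ev (h ^ m) p) \<le> 1"
    using order_trans[OF norm_ev_le assms] by (simp add: ev_power norm_power power_le_one del: mem_Times_iff)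
qed

text \<open>High powers of peak functions with distinct peaks have almost disjoint supports, so that the
  supremum of a sum is about the largest of the peak values.  The sums decrease with \<open>m\<close>, and their
  pointwise limit keeps at most one term; compactness makes this uniform as in Dini's theorem.\<close>
lemma peaks_separate:
  fixes g E :: "'i \<Rightarrow> 'a::metric_space \<Rightarrow> complex" and q :: "'i \<Rightarrow> 'a"
  assumes K: "compact K" and I: "finite I" and q: "inj_on q I"
    and g: "\<And>k. k \<in> I \<Longrightarrow> continuous_on K (g k)" and E: "\<And>k. k \<in> I \<Longrightarrow> continuous_on K (E k)"
    and E_le: "\<And>k z. k \<in> I \<Longrightarrow> z \<in> K \<Longrightarrow> norm (E k z) \<le> 1"
    and E_lt: "\<And>k z. k \<in> I \<Longrightarrow> z \<in> K \<Longrightarrow> z \<noteq> q k \<Longrightarrow> norm (E k z) < 1"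
    and c: "0 < c" "\<And>k. k \<in> I \<Longrightarrow> norm (g k (q k)) < c"
  shows "\<exists>M. \<forall>m\<ge>M. \<forall>z\<in>K. (\<Sum>k\<in>I. norm (g k z) * norm (E k z) ^ m) < c"
proof -
  define S where "S m z = (\<Sum>k\<in>I. norm (g k z) * norm (E k z) ^ m)" for m z
  have mono: "S m' z \<le> S m z" if "m \<le> m'" "z \<in> K" for m m' z
    unfolding S_def using that E_le by (intro sum_mono mult_left_mono power_decreasing) auto
  have cont: "continuous_on K (S m)" for m
    unfolding S_def by (intro continuous_intros g E)
  have pointwise: "\<exists>m. S m z < c" if z: "z \<in> K" for z
  proof -
    define G where "G k m = norm (g k z) * (if z = q k then 1 else norm (E k z) ^ m)" for k m
    have "(\<lambda>m. G k m) \<longlonglongrightarrow> (if z = q k then norm (g k z) else 0)" if "k \<in> I" for k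
      unfolding G_def using tendsto_mult_left[OF LIMSEQ_realpow_zero[OF norm_ge_zero E_lt[OF that z]], of "norm (g k z)"]
      by auto
    then have "(\<lambda>m. \<Sum>k\<in>I. G k m) \<longlonglongrightarrow> (\<Sum>k\<in>I. if z = q k then norm (g k z) else 0)"
      by (rule tendsto_sum)
    moreover have "(\<Sum>k\<in>I. if z = q k then norm (g k z) else 0) < c"
    proof (cases "\<exists>j\<in>I. z = q j")
      case True
      then obtain j where j: "j \<in> I" "z = q j" by blast
      have "(\<Sum>k\<in>I. if z = q k then norm (g k z) else 0) = (\<Sum>k\<in>I. if k = j then norm (g j z) else 0)"
        using j q by (intro sum.cong) (auto simp: inj_on_def)
      then show ?thesis using j I c(2)[OF j(1)] by simp
    next
      case False
      then show ?thesis using c(1) by (simp add: sum.neutral)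
    qed
    ultimately have "\<forall>\<^sub>F m in sequentially. (\<Sum>k\<in>I. G k m) < c" by (rule order_tendstoD(2))
    then obtain m where "(\<Sum>k\<in>I. G k m) < c" by (auto simp: eventually_sequentially)
    moreover have "S m z \<le> (\<Sum>k\<in>I. G k m)"
      unfolding S_def G_def using z E_le by (intro sum_mono mult_left_mono) (auto simp: power_le_one)
    ultimately show ?thesis by (intro exI[of _ m]) simp
  qed
  have "\<exists>M. \<forall>z\<in>K. S M z < c"
  proof (rule ccontr)
    assume "\<not> ?thesis"
    then obtain Z where Z: "\<And>m. Z m \<in> K" "\<And>m. c \<le> S m (Z m)" by (metis not_le)
    obtain z and \<rho> :: "nat \<Rightarrow> nat" where z: "z \<in> K" "strict_mono \<rho>" "(Z \<circ> \<rho>) \<longlonglongrightarrow> z"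
      using K[unfolded compact_def, rule_format, of Z] Z(1) by blast
    obtain m where m: "S m z < c" using pointwise[OF z(1)] by blast
    have "(\<lambda>j. S m (Z (\<rho> j))) \<longlonglongrightarrow> S m z"
      using continuous_on_tendsto_compose[OF cont z(3) z(1)] Z(1) by (simp add: o_def)
    then have "\<forall>\<^sub>F j in sequentially. S m (Z (\<rho> j)) < c" using m by (rule order_tendstoD(2))
    moreover have "\<forall>\<^sub>F j in sequentially. c \<le> S m (Z (\<rho> j))"
      using eventually_ge_at_top[of m]
    proof eventually_elim
      case (elim j)
      then have "m \<le> \<rho> j" using seq_suble[OF z(2), of j] by simp
      then show ?case using mono[OF _ Z(1), of m "\<rho> j" "\<rho> j"] Z(2)[of "\<rho> j"] by simp
    qed
    ultimately have "\<forall>\<^sub>F j in sequentially. False" by eventually_elim simp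
    then show False by simp
  qed
  then obtain M where "\<And>z. z \<in> K \<Longrightarrow> S M z < c" by blast
  then have "\<forall>m\<ge>M. \<forall>z\<in>K. S m z < c" using mono by (meson le_less_trans)
  then show ?thesis unfolding S_def by blast
qed

section \<open>Approximate eigenfunctions on the corner circles\<close>

lemma islimpt_unit_circle:
  assumes "x \<in> sphere (0::complex) 1"
  shows "x islimpt sphere 0 1"
proof (rule connected_imp_perfect)
  show "connected (sphere (0::complex) 1)" by (simp add: connected_sphere_eq DIM_complex)
  have "1 \<in> sphere (0::complex) 1" "-1 \<in> sphere (0::complex) 1" by auto
  then show "sphere (0::complex) 1 \<noteq> {a}" for a by (metis one_neq_neg_one singletonD)
  show "x \<in> sphere 0 1" by (rule assms)
qed

lemma summation_by_parts:
  fixes a X :: "nat \<Rightarrow> 'a::comm_ring"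
  shows "(\<Sum>k<Suc n. a k * (X k - X (Suc k))) = a 0 * X 0 - a n * X (Suc n) + (\<Sum>k<n. (a (Suc k) - a k) * X (Suc k))"
  by (induction n) (simp_all add: algebra_simps)

context weighted_composition
begin

text \<open>Choose a point \<open>(z, y)\<close> of the torus so close to the corner \<open>P = (x, y)\<close> that
  \<open>|W k| / |l|\<^sup>k\<close> stays between \<open>1/2\<close> and \<open>2\<close> along \<open>2 * N\<close> backward steps, and let \<open>h\<close> peak at \<open>(z, y)\<close>.  The
  functions \<open>l\<^sup>-\<^sup>k T\<^sup>k (h\<^sup>m)\<close> peak at the distinct points \<open>q k = \<Phi>\<^sup>-\<^sup>k (z, y)\<close>, with peak values of modulus between
  \<open>1/2\<close> and \<open>2\<close>.  Give them tent-shaped coefficients \<open>a k\<close>.  Applying \<open>l - T\<close> to the sum replaces the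
  coefficients by their differences, of modulus at most \<open>1/N\<close>; thus the image has norm at most
  \<open>2 |l| / N\<close>, while the sum has norm at least \<open>1/2\<close>.\<close>
lemma not_bounded_below_pencil:
  assumes P: "P \<in> {s1, s2} \<times> {t1, t2}" and l: "norm l = norm (ev w P)"
  shows "\<not> bounded_below (pencil T l)"
proof
  assume "bounded_below (pencil T l)"
  then obtain \<delta> where \<delta>: "\<delta> > 0" "\<And>f. \<delta> * norm f \<le> norm (pencil T l f)"
    by (auto simp: bounded_below_def)
  obtain x y where xy: "P = (x, y)" "x \<in> {s1, s2}" "y \<in> {t1, t2}" using P by blast
  have x: "x \<in> sphere 0 1" "(\<phi>' ^^ n) x = x" for n
    using xy S.attracting S.repelling S.iterate_fixed by auto
  have y: "y \<in> sphere 0 1" "(\<psi>' ^^ n) y = y" for n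
    using xy R.attracting R.repelling R.iterate_fixed by auto
  have Pb: "P \<in> bidisc" using x y xy by auto
  have l0: "norm l > 0" using w_nonzero[OF Pb] l by simp
  \<comment> \<open>Then \<open>\<delta> / 2 > norm l * (2 / N)\<close>, which contradicts the two norm bounds below.\<close>
  obtain N where N: "real N > 4 * norm l / \<delta>" using reals_Archimedean2 by blast
  have "0 < 4 * norm l / \<delta>" using \<delta>(1) l0 by simp
  then have N0: "N > 0" using N by linarith
  define v where "v k p = norm (W k ((\<Phi>' ^^ k) p)) / norm l ^ k" for k p
  have v_cont: "continuous_on bidisc (v k)" for k
  proof -
    have "continuous_on bidisc (\<lambda>p. W k ((\<Phi>' ^^ k) p))"
      by (rule continuous_on_compose2[OF continuous_on_W continuous_on_iterate_\<Phi>(2)]) (use iterate_bidisc in blast)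
    then show ?thesis unfolding v_def using l0 by (intro continuous_intros) auto
  qed
  have vP: "v k P = 1" for k
  proof -
    have "(\<Phi>' ^^ n) P = P" for n using x y by (simp add: \<Phi>'_iterate xy(1))
    note fixP = this
    have "W k ((\<Phi>' ^^ k) P) = ev w P ^ k"
      using W_backward[OF Pb, of k] unfolding fixP by simp
    then show ?thesis using l l0 by (simp add: v_def norm_power)
  qed
  obtain z where z: "z \<in> sphere 0 1" "z \<noteq> s1" "z \<noteq> s2"
    and vz: "\<And>k. k \<le> 2 * N \<Longrightarrow> 1 / 2 < v k (z, y) \<and> v k (z, y) < 2"
  proof -
    have nb: "at x within sphere 0 1 \<noteq> bot"
      using islimpt_unit_circle[OF x(1)] by (simp add: trivial_limit_within)
    have "\<forall>\<^sub>F z in at x within sphere 0 1. 1 / 2 < v k (z, y) \<and> v k (z, y) < 2" for k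
    proof -
      have "continuous_on (sphere 0 1) (\<lambda>z. v k (z, y))"
        using y(1) by (intro continuous_on_compose2[OF v_cont] continuous_intros) auto
      then have lim: "((\<lambda>z. v k (z, y)) \<longlongrightarrow> 1) (at x within sphere 0 1)"
        using x(1) vP[of k] unfolding continuous_on_def xy(1) by metis
      show ?thesis
        by (intro eventually_conj order_tendstoD(1)[OF lim] order_tendstoD(2)[OF lim]) auto
    qed
    then have "\<forall>\<^sub>F z in at x within sphere 0 1. \<forall>k\<in>{..2 * N}. 1 / 2 < v k (z, y) \<and> v k (z, y) < 2"
      by (intro eventually_ball_finite) auto
    moreover have "\<forall>\<^sub>F z in at x within sphere 0 1. z \<in> sphere 0 1 \<and> z \<noteq> s1 \<and> z \<noteq> s2"
      unfolding eventually_at using xy(2) S.distinct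
      by (intro exI[of _ "dist s1 s2"]) (auto simp: dist_commute)
    ultimately have "\<forall>\<^sub>F z in at x within sphere 0 1. (z \<in> sphere 0 1 \<and> z \<noteq> s1 \<and> z \<noteq> s2)
        \<and> (\<forall>k\<in>{..2 * N}. 1 / 2 < v k (z, y) \<and> v k (z, y) < 2)"
      by eventually_elim auto
    then show thesis using eventually_happens'[OF nb] that by fastforce
  qed
  define q where "q k = (\<Phi>' ^^ k) (z, y)" for k
  have q0: "(z, y) \<in> bidisc" using z y by auto
  have qb: "q k \<in> bidisc" for k unfolding q_def by (rule iterate_bidisc(2)[OF q0])
  have q_inv: "(\<Phi> ^^ k) (q k) = (z, y)" for k unfolding q_def by (rule iterate_inverse(2)[OF q0])
  have q_eq: "p = q k" if "p \<in> bidisc" "(\<Phi> ^^ k) p = (z, y)" for p k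
    using iterate_inverse(1)[OF that(1), of k] that(2) by (simp add: q_def)
  \<comment> \<open>The second coordinate stays fixed; the first one is not periodic.\<close>
  have q_inj: "j = k" if "q j = q k" for j k
  proof -
    have zc: "z \<in> cball 0 1" using z by auto
    have "(\<Phi> ^^ (j + k)) (q j) = (\<Phi> ^^ (k + j)) (q k)" using that by (simp add: add.commute)
    then have "(\<Phi> ^^ k) (z, y) = (\<Phi> ^^ j) (z, y)"
      by (simp add: funpow_add q_inv) (metis add.commute funpow_add o_apply q_inv that)
    then have "(\<phi> ^^ k) z = (\<phi> ^^ j) z" by (simp add: \<Phi>_iterate)
    then show ?thesis using S.no_periodic_points[OF zc z(2,3)] by metis
  qed
  obtain h where h: "ev h (z, y) = 1" "norm h \<le> 1" "\<And>p. p \<in> bidisc \<Longrightarrow> p \<noteq> (z, y) \<Longrightarrow> norm (ev h p) < 1"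
    using peak_function[of "(z, y)"] z y by auto
  define E where "E k p = ev h ((\<Phi> ^^ k) p)" for k p
  define g where "g k p = W k p / l ^ k" for k p
  have gv: "norm (g k (q k)) = v k (z, y)" for k
    by (simp add: g_def v_def q_def norm_divide norm_power)
  have E_lt: "norm (E k p) < 1" if "p \<in> bidisc" "p \<noteq> q k" for k p
    unfolding E_def using h(3)[OF iterate_bidisc(1)[OF that(1)]] q_eq that by blast
  have E_le: "norm (E k p) \<le> 1" for k p
    unfolding E_def by (rule order_trans[OF norm_ev_le h(2)])
  have E_cont: "continuous_on bidisc (E k)" for k unfolding E_def by (rule continuous_on_ev_iterate)
  have g_cont: "continuous_on bidisc (g k)" for k
    unfolding g_def using l0 by (intro continuous_intros continuous_on_W) auto
  define a :: "nat \<Rightarrow> real" where "a k = min (real k) (real (2 * N) - real k) / N" for k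
  have a0: "a 0 = 0" "a (2 * N) = 0" "a N = 1" using N0 by (simp_all add: a_def)
  have a_diff: "\<bar>a (Suc k) - a k\<bar> \<le> 1 / N" for k
  proof -
    have "\<bar>min (real (Suc k)) (real (2 * N) - real (Suc k)) - min (real k) (real (2 * N) - real k)\<bar> \<le> 1" by linarith
    then show ?thesis using N0 unfolding a_def diff_divide_distrib[symmetric] abs_divide
      by (simp add: divide_right_mono)
  qed
  define f where "f m = (\<Sum>k<Suc (2 * N). (complex_of_real (a k) / l ^ k) *\<^sub>C (T ^^ k) (h ^ m))" for m
  define X where "X m k p = g k p * E k p ^ m" for m k p
  have ev_sum: "ev (sum F A) p = (\<Sum>k\<in>A. ev (F k) p)" for F :: "nat \<Rightarrow> bidisc_algebra" and A p
    by (induction A rule: infinite_finite_induct) auto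
  have ev_f: "ev (f m) p = (\<Sum>k<Suc (2 * N). a k * X m k p)" if p: "p \<in> bidisc" for m p
    unfolding f_def ev_sum
    by (intro sum.cong refl) (use p in \<open>simp add: T_power ev_power[OF iterate_bidisc(1)] X_def g_def E_def del: mem_Times_iff\<close>)
  have X_step: "ev w p * X m k (\<Phi> p) = l * X m (Suc k) p" for m k p
    using l0 by (simp add: X_def g_def E_def W_Suc' funpow_swap1)
  have ev_pf: "ev (pencil T l (f m)) p = l * (\<Sum>k<2 * N. (a (Suc k) - a k) * X m (Suc k) p)" if p: "p \<in> bidisc" for m p
  proof -
    have "ev (pencil T l (f m)) p = l * ev (f m) p - ev w p * ev (f m) (\<Phi> p)"
      using p by (simp add: pencil_def T_eq \<Phi>_def del: mem_Times_iff)
    also have "\<dots> = (\<Sum>k<Suc (2 * N). a k * (l * X m k p) - a k * (ev w p * X m k (\<Phi> p)))"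
      unfolding ev_f[OF p] ev_f[OF \<Phi>_bidisc(1)[OF p]] sum_distrib_left sum_subtractf
      by (simp only: mult.left_commute)
    also have "\<dots> = l * (\<Sum>k<Suc (2 * N). complex_of_real (a k) * (X m k p - X m (Suc k) p))"
      unfolding X_step sum_distrib_left by (intro sum.cong refl) (simp add: algebra_simps)
    also have "\<dots> = l * (\<Sum>k<2 * N. (complex_of_real (a (Suc k)) - complex_of_real (a k)) * X m (Suc k) p)"
      using summation_by_parts[of "\<lambda>k. complex_of_real (a k)" "\<lambda>k. X m k p" "2 * N"]
      by (simp only: a0 of_real_0 mult_zero_left diff_zero add_0)
    finally show ?thesis by simp
  qed
  have "\<exists>M. \<forall>m\<ge>M. \<forall>p\<in>bidisc. (\<Sum>k<2 * N. norm (g (Suc k) p / N) * norm (E (Suc k) p) ^ m) < 2 / N"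
  proof (rule peaks_separate[OF compact_bidisc, where q = "\<lambda>k. q (Suc k)"])
    show "norm (g (Suc k) (q (Suc k)) / N) < 2 / N" if "k \<in> {..<2 * N}" for k
      using vz[of "Suc k"] that N0 by (simp add: norm_divide gv divide_strict_right_mono)
    show "inj_on (\<lambda>k. q (Suc k)) {..<2 * N}" using q_inj by (auto simp: inj_on_def)
    show "continuous_on bidisc (\<lambda>p. g (Suc k) p / N)" for k
      using N0 by (intro continuous_intros g_cont) auto
  qed (use N0 E_cont E_le E_lt in auto)
  then obtain M where M: "\<And>m p. m \<ge> M \<Longrightarrow> p \<in> bidisc \<Longrightarrow>
      (\<Sum>k<2 * N. norm (g (Suc k) p / N) * norm (E (Suc k) p) ^ m) < 2 / N" by blast
  have upper: "norm (pencil T l (f m)) \<le> norm l * (2 / N)" if m: "m \<ge> M" for m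
  proof (rule norm_bidisc_algebra_le)
    fix p :: "complex \<times> complex" assume p: "p \<in> bidisc"
    have "norm (\<Sum>k<2 * N. complex_of_real (a (Suc k) - a k) * X m (Suc k) p)
        \<le> (\<Sum>k<2 * N. norm (g (Suc k) p / N) * norm (E (Suc k) p) ^ m)"
    proof (rule order_trans[OF norm_sum sum_mono])
      fix k
      have "norm (complex_of_real (a (Suc k) - a k) * X m (Suc k) p) = \<bar>a (Suc k) - a k\<bar> * norm (X m (Suc k) p)"
        unfolding norm_mult norm_of_real ..
      also have "\<dots> \<le> 1 / N * norm (X m (Suc k) p)"
        by (intro mult_right_mono a_diff) simp
      finally show "norm (complex_of_real (a (Suc k) - a k) * X m (Suc k) p) \<le> norm (g (Suc k) p / N) * norm (E (Suc k) p) ^ m"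
        by (simp add: X_def norm_mult norm_power norm_divide)
    qed
    also have "\<dots> \<le> 2 / N" using M[OF m p] by simp
    finally show "norm (ev (pencil T l (f m)) p) \<le> norm l * (2 / N)"
      unfolding ev_pf[OF p] norm_mult by (intro mult_left_mono) auto
  qed
  have "(\<lambda>m. ev (f m) (q N)) \<longlonglongrightarrow> (\<Sum>k<Suc (2 * N). if k = N then g N (q N) else 0)"
    unfolding ev_f[OF qb]
  proof (rule tendsto_sum)
    fix k
    show "(\<lambda>m. complex_of_real (a k) * X m k (q N)) \<longlonglongrightarrow> (if k = N then g N (q N) else 0)"
    proof (cases "k = N")
      case True
      then show ?thesis by (simp add: X_def a0 E_def q_inv h(1))
    next
      case False
      then have "norm (E k (q N)) < 1" using q_inj by (intro E_lt qb) auto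
      then have "(\<lambda>m. E k (q N) ^ m) \<longlonglongrightarrow> 0" by (rule LIMSEQ_power_zero)
      then have "(\<lambda>m. complex_of_real (a k) * (g k (q N) * E k (q N) ^ m)) \<longlonglongrightarrow> complex_of_real (a k) * (g k (q N) * 0)"
        by (intro tendsto_mult_left)
      then show ?thesis using False by (simp add: X_def)
    qed
  qed
  then have "(\<lambda>m. norm (ev (f m) (q N))) \<longlonglongrightarrow> norm (g N (q N))"
    using N0 by (intro tendsto_norm) simp
  moreover have "1 / 2 < norm (g N (q N))" using vz[of N] by (simp add: gv)
  ultimately have "\<forall>\<^sub>F m in sequentially. 1 / 2 < norm (ev (f m) (q N))" by (rule order_tendstoD(1))
  then obtain m where m: "m \<ge> M" "1 / 2 < norm (ev (f m) (q N))"
    by (auto simp: eventually_sequentially) (metis nat_le_linear)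
  have "\<delta> * (1 / 2) \<le> \<delta> * norm (f m)"
    using m(2) norm_ev_le[of "f m" "q N"] \<delta>(1) by (intro mult_left_mono) auto
  also have "\<dots> \<le> norm l * (2 / N)" using \<delta>(2) upper[OF m(1)] by (rule order_trans)
  finally have "\<delta> * N \<le> 4 * norm l" using N0 by (simp add: field_simps)
  then show False using N \<delta>(1) by (simp add: field_simps)
qed

section \<open>Functionals that nearly annihilate the range\<close>

text \<open>The sum over the \<open>2 * n + 1\<close> orbit points around \<open>p\<close>, parametrised from its first point \<open>q = \<Phi>\<^sup>-\<^sup>n p\<close> and
  normalised to have coefficient \<open>1\<close> at \<open>p\<close> itself (the term \<open>k = n\<close>).\<close>
definition orbit_functional :: "complex \<Rightarrow> nat \<Rightarrow> complex \<times> complex \<Rightarrow> bidisc_algebra \<Rightarrow> complex" where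
  "orbit_functional l n p f = (let q = (\<Phi>' ^^ n) p in
     \<Sum>k<Suc (2 * n). (W k q / l ^ k) / (W n q / l ^ n) * ev f ((\<Phi> ^^ k) q))"

lemma orbit_functional_linear:
  "orbit_functional l n p (f + g) = orbit_functional l n p f + orbit_functional l n p g"
  "orbit_functional l n p (c *\<^sub>C f) = c * orbit_functional l n p f"
  unfolding orbit_functional_def Let_def
  by (simp_all only: plus_bidisc_algebra.rep_eq ev_cscale distrib_left sum.distrib sum_distrib_left mult.left_commute)

lemma bounded_linear_orbit_functional: "bounded_linear (orbit_functional l n p)"
proof (rule bounded_linear_intro)
  let ?q = "(\<Phi>' ^^ n) p"
  show "orbit_functional l n p (f + g) = orbit_functional l n p f + orbit_functional l n p g" for f g
    by (rule orbit_functional_linear)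
  show "orbit_functional l n p (r *\<^sub>R f) = r *\<^sub>R orbit_functional l n p f" for r f
    by (simp add: orbit_functional_linear scaleR_conv_of_real flip: cscale_of_real)
  show "norm (orbit_functional l n p f) \<le> norm f * (\<Sum>k<Suc (2 * n). norm ((W k ?q / l ^ k) / (W n ?q / l ^ n)))" for f
    unfolding orbit_functional_def Let_def sum_distrib_left
  proof (rule order_trans[OF norm_sum sum_mono])
    show "norm ((W k ?q / l ^ k) / (W n ?q / l ^ n) * ev f ((\<Phi> ^^ k) ?q))
        \<le> norm f * norm ((W k ?q / l ^ k) / (W n ?q / l ^ n))" for k
      unfolding norm_mult mult.commute[of "norm f"] by (intro mult_left_mono norm_ev_le norm_ge_zero)
  qed
qed

definition orbit_error where
  "orbit_error l n p = norm l * (norm l ^ n / norm (W n ((\<Phi>' ^^ n) p)) + norm (W (Suc n) p) / norm l ^ Suc n)"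

text \<open>The sum telescopes; \<open>orbit_error\<close> collects the two boundary terms at the ends of the orbit piece.\<close>
lemma orbit_functional_pencil:
  assumes p: "p \<in> bidisc" and l: "l \<noteq> 0"
  shows "norm (orbit_functional l n p (pencil T l f)) \<le> orbit_error l n p * norm f"
proof -
  define q where "q = (\<Phi>' ^^ n) p"
  have q: "q \<in> bidisc" "(\<Phi> ^^ n) q = p"
    unfolding q_def by (rule iterate_bidisc(2)[OF p], rule iterate_inverse(2)[OF p])
  define D where "D = W n q / l ^ n"
  have Wn: "W n q \<noteq> 0" by (rule W_nonzero[OF q(1)])
  define Y where "Y k = W k q / l ^ k / D * ev f ((\<Phi> ^^ k) q)" for k
  have "orbit_functional l n p (pencil T l f) = (\<Sum>k<Suc (2 * n). l * (Y k - Y (Suc k)))"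
    unfolding orbit_functional_def Let_def q_def[symmetric] D_def[symmetric]
  proof (intro sum.cong refl)
    fix k
    have "ev (pencil T l f) ((\<Phi> ^^ k) q) = l * ev f ((\<Phi> ^^ k) q) - ev w ((\<Phi> ^^ k) q) * ev f ((\<Phi> ^^ Suc k) q)"
      using T_eq[OF iterate_bidisc(1)[OF q(1)], of f k] by (simp add: pencil_def \<Phi>_def)
    then show "W k q / l ^ k / D * ev (pencil T l f) ((\<Phi> ^^ k) q) = l * (Y k - Y (Suc k))"
      using l by (simp add: Y_def W_Suc right_diff_distrib mult_ac)
  qed
  also have "\<dots> = l * (Y 0 - Y (Suc (2 * n)))"
    by (simp only: sum_distrib_left[symmetric] sum_lessThan_telescope')
  finally have eq: "orbit_functional l n p (pencil T l f) = l * (Y 0 - Y (Suc (2 * n)))" .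
  have Y0: "norm (Y 0) \<le> norm l ^ n / norm (W n q) * norm f"
  proof -
    have "Y 0 = l ^ n / W n q * ev f q" by (simp add: Y_def D_def)
    then show ?thesis
      by (simp only: norm_mult norm_divide norm_power) (intro mult_left_mono norm_ev_le divide_nonneg_nonneg, auto)
  qed
  have YN: "norm (Y (Suc (2 * n))) \<le> norm (W (Suc n) p) / norm l ^ Suc n * norm f"
  proof -
    have "W (Suc (2 * n)) q = W n q * W (Suc n) p"
      using W_add[of n "Suc n" q] q(2) by (simp add: mult_2)
    then have "Y (Suc (2 * n)) = W (Suc n) p / l ^ Suc n * ev f ((\<Phi> ^^ Suc (2 * n)) q)"
      using Wn l by (simp add: Y_def D_def mult_2 power_add del: funpow.simps)
    then show ?thesis
      by (simp only: norm_mult norm_divide norm_power) (intro mult_left_mono norm_ev_le divide_nonneg_nonneg, auto)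
  qed
  have "norm (Y 0 - Y (Suc (2 * n))) \<le> norm l ^ n / norm (W n q) * norm f + norm (W (Suc n) p) / norm l ^ Suc n * norm f"
    using norm_triangle_ineq4 Y0 YN by (meson add_mono order_trans)
  then show ?thesis
    unfolding eq norm_mult orbit_error_def q_def[symmetric] mult.assoc distrib_right
    by (intro mult_left_mono) auto
qed

lemma orbit_error_tendsto_0:
  assumes p: "p \<in> bidisc" and l: "forward_weight p < norm l" "norm l < backward_weight p"
  shows "(\<lambda>n. orbit_error l n p) \<longlonglongrightarrow> 0"
proof -
  have "(\<lambda>n. orbit_error l n p) \<longlonglongrightarrow> norm l * (0 + 0)"
    unfolding orbit_error_def
    by (intro tendsto_intros backward_tendsto_0[OF p l(2)] LIMSEQ_Suc[OF forward_tendsto_0[OF p l(1)]])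
  then show ?thesis by simp
qed

text \<open>Powers of a peak function converge to the indicator of the peak, so they read off the coefficient at the peak.\<close>
lemma orbit_functional_peak:
  assumes p: "p \<in> bidisc" and q: "q \<in> bidisc" and l: "l \<noteq> 0"
    and h: "ev h q = 1" "\<And>u. u \<in> bidisc \<Longrightarrow> u \<noteq> q \<Longrightarrow> norm (ev h u) < 1"
    and orb: "\<And>k. (\<Phi> ^^ k) ((\<Phi>' ^^ n) p) = q \<Longrightarrow> p = q \<and> k = n"
  shows "(\<lambda>m. orbit_functional l n p (h ^ m)) \<longlonglongrightarrow> (if p = q then 1 else 0)"
proof -
  let ?u = "(\<Phi>' ^^ n) p"
  have u: "(\<Phi> ^^ k) ?u \<in> bidisc" for k by (intro iterate_bidisc p)
  have "(\<lambda>m. orbit_functional l n p (h ^ m)) \<longlonglongrightarrow> (\<Sum>k<Suc (2 * n). if k = n then (if p = q then 1 else 0) else 0)"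
    unfolding orbit_functional_def Let_def ev_power[OF u]
  proof (rule tendsto_sum)
    fix k
    let ?c = "(W k ?u / l ^ k) / (W n ?u / l ^ n)"
    show "(\<lambda>m. ?c * ev h ((\<Phi> ^^ k) ?u) ^ m) \<longlonglongrightarrow> (if k = n then if p = q then 1 else 0 else 0)"
    proof (cases "k = n \<and> p = q")
      case True
      then show ?thesis using W_nonzero[OF iterate_bidisc(2)[OF p]] l by (simp add: iterate_inverse(2)[OF q] h(1))
    next
      case False
      then have "norm (ev h ((\<Phi> ^^ k) ?u)) < 1" using orb by (intro h(2) u) blast
      then have "(\<lambda>m. ?c * ev h ((\<Phi> ^^ k) ?u) ^ m) \<longlonglongrightarrow> ?c * 0"
        by (intro tendsto_mult_left LIMSEQ_power_zero)
      then show ?thesis using False by auto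
    qed
  qed
  moreover have "(\<Sum>k<Suc (2 * n). if k = n then (if p = q then 1 else 0) else 0) = (if p = q then 1 else (0::complex))"
    by (subst sum.delta) auto
  ultimately show ?thesis by (simp only:)
qed

text \<open>Suppose the range of \<open>l - T\<close> together with the finite set \<open>B\<close> spans everything.  Replace \<open>l\<close> by a nearby
  \<open>m\<close> with \<open>|w (s1, t1)| < |m| < |w (s2, t2)|\<close>, for which the orbit functionals have small error.  Take more than \<open>card B\<close>
  points on the torus, all with first coordinate \<open>x\<close>, and combine their orbit functionals to a functional \<open>\<nu>\<close>
  that vanishes on \<open>B\<close> and whose largest coefficient is \<open>1\<close>.  The dual estimate bounds the norm \<open>K\<close> of \<open>\<nu>\<close> by
  \<open>1/4 + K/4\<close>, while a peak function shows \<open>K \<ge> 1\<close>.\<close>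
lemma not_lower_semi_fredholm:
  assumes gap: "norm (ev w (s1, t1)) < norm (ev w (s2, t2))"
    and l: "norm (ev w (s1, t1)) \<le> norm l" "norm l \<le> norm (ev w (s2, t2))"
  shows "\<not> lower_semi_fredholm (pencil T l)"
proof
  assume "lower_semi_fredholm (pencil T l)"
  then obtain B C where B: "finite B" and C: "C \<ge> 0"
    and est: "\<And>(\<nu> :: bidisc_algebra \<Rightarrow> complex) e y. \<lbrakk>bounded_linear \<nu>; \<And>c x. \<nu> (c *\<^sub>C x) = c * \<nu> x; \<And>b. b \<in> B \<Longrightarrow> \<nu> b = 0;
            0 \<le> e; \<And>x. norm (\<nu> (pencil T l x)) \<le> e * norm x\<rbrakk> \<Longrightarrow> norm (\<nu> y) \<le> C * e * norm y"
    using lower_semi_fredholm_functional_estimate by metis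
  have "(s1, t1) \<in> bidisc" using S.s_cball R.s_cball by simp
  then have "norm l > 0" using l w_nonzero by (metis less_le_trans zero_less_norm_iff)
  \<comment> \<open>Moving \<open>l\<close> radially by at most \<open>\<eta>\<close> reaches the open annulus.\<close>
  obtain m where m: "norm (ev w (s1, t1)) < norm m" "norm m < norm (ev w (s2, t2))" "norm (l - m) * C \<le> 1 / 4" "m \<noteq> 0"
  proof -
    define \<eta> where "\<eta> = 1 / (4 * (C + 1))"
    have \<eta>: "\<eta> > 0" "\<eta> * C \<le> 1 / 4" using C by (auto simp: \<eta>_def field_simps)
    have "max (norm (ev w (s1, t1))) (norm l - \<eta>) < min (norm (ev w (s2, t2))) (norm l + \<eta>)"
      using gap l \<eta> by auto
    then obtain t where t: "max (norm (ev w (s1, t1))) (norm l - \<eta>) < t" "t < min (norm (ev w (s2, t2))) (norm l + \<eta>)"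
      using dense by blast
    define m where "m = (t / norm l) *\<^sub>R l"
    have t0: "t > 0" using t le_less_trans[OF norm_ge_zero, of "ev w (s1, t1)" t] by simp
    have "norm m = t" using t0 \<open>norm l > 0\<close> by (simp add: m_def)
    moreover have "norm (l - m) \<le> \<eta>"
    proof -
      have "l - m = ((norm l - t) / norm l) *\<^sub>R l"
        using \<open>norm l > 0\<close> by (simp add: m_def diff_divide_distrib scaleR_left_diff_distrib)
      then have "norm (l - m) = \<bar>norm l - t\<bar>" using \<open>norm l > 0\<close> by simp
      then show ?thesis using t by auto
    qed
    ultimately show thesis using t t0 \<eta> C mult_right_mono[of "norm (l - m)" \<eta> C] by (intro that[of m]) auto
  qed
  have inf: "infinite (sphere 0 1 - {a, b :: complex})" for a b
  proof -
    have "infinite (sphere 0 1 :: complex set)"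
      using islimpt_finite islimpt_unit_circle[OF S.attracting(1)] by blast
    then show ?thesis by simp
  qed
  obtain x where x: "x \<in> sphere 0 1" "x \<noteq> s1" "x \<noteq> s2" using infinite_imp_nonempty[OF inf] by blast
  obtain Y where Y: "finite Y" "card Y = Suc (card B)" "Y \<subseteq> sphere 0 1 - {t1, t2}"
    using infinite_arbitrarily_large[OF inf] by metis
  have Yb: "(x, y) \<in> bidisc" "forward_weight (x, y) < norm m" "norm m < backward_weight (x, y)" if "y \<in> Y" for y
  proof -
    have y: "y \<in> sphere 0 1" "y \<noteq> t1" "y \<noteq> t2" using Y that by auto
    show "(x, y) \<in> bidisc" using x y by auto
    show "forward_weight (x, y) < norm m" "norm m < backward_weight (x, y)" using x y m
      by (simp_all add: forward_weight_def backward_weight_def S.forward_limit_def R.forward_limit_def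
          S.backward_limit_def R.backward_limit_def)
  qed
  \<comment> \<open>The \<open>card Y\<close> orbit errors then contribute at most \<open>1 / 4\<close> to the bound for \<open>K\<close>.\<close>
  define \<epsilon> where "\<epsilon> = 1 / (4 * (C + 1) * card Y)"
  have \<epsilon>: "\<epsilon> > 0" "C * (card Y * \<epsilon>) \<le> 1 / 4"
  proof -
    have c: "real (card Y) > 0" using Y by simp
    then show "\<epsilon> > 0" using C unfolding \<epsilon>_def by (intro divide_pos_pos mult_pos_pos) auto
    have eq: "card Y * \<epsilon> = 1 / (4 * (C + 1))" using c by (simp add: \<epsilon>_def)
    show "C * (card Y * \<epsilon>) \<le> 1 / 4" unfolding eq using C by (simp add: field_simps)
  qed
  have "\<forall>\<^sub>F n in sequentially. \<forall>y\<in>Y. orbit_error m n (x, y) < \<epsilon>"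
    using Y(1) Yb \<epsilon>(1) by (intro eventually_ball_finite ballI order_tendstoD(2)[OF orbit_error_tendsto_0]) auto
  then obtain n where n: "\<And>y. y \<in> Y \<Longrightarrow> orbit_error m n (x, y) < \<epsilon>" by (auto simp: eventually_sequentially)
  define \<nu>0 where "\<nu>0 y = orbit_functional m n (x, y)" for y
  have "card B < card Y" using Y by simp
  then obtain \<alpha> where \<alpha>: "\<exists>y\<in>Y. \<alpha> y \<noteq> 0" "\<And>b. b \<in> B \<Longrightarrow> (\<Sum>y\<in>Y. \<alpha> y * \<nu>0 y b) = 0"
    using homogeneous_system_nontrivial_solution[OF B Y(1), of \<nu>0] by blast
  have "Y \<noteq> {}" using \<alpha>(1) by blast
  then obtain y0 where y0: "y0 \<in> Y" "\<And>y. y \<in> Y \<Longrightarrow> norm (\<alpha> y) \<le> norm (\<alpha> y0)"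
    using Y(1) Max_in[of "(\<lambda>y. norm (\<alpha> y)) ` Y"] Max_ge[of "(\<lambda>y. norm (\<alpha> y)) ` Y"] by fastforce
  have \<alpha>0: "\<alpha> y0 \<noteq> 0" using \<alpha>(1) y0(2) by fastforce
  define \<beta> where "\<beta> y = \<alpha> y / \<alpha> y0" for y
  have \<beta>: "\<beta> y0 = 1" "\<And>y. y \<in> Y \<Longrightarrow> norm (\<beta> y) \<le> 1"
    using \<alpha>0 y0(2) by (auto simp: \<beta>_def norm_divide)
  define \<nu> where "\<nu> f = (\<Sum>y\<in>Y. \<beta> y * \<nu>0 y f)" for f
  have bl: "bounded_linear \<nu>"
    unfolding \<nu>_def \<nu>0_def
    by (intro bounded_linear_sum bounded_linear_const_mult bounded_linear_orbit_functional)
  have lin: "\<nu> (c *\<^sub>C f) = c * \<nu> f" for c f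
    unfolding \<nu>_def \<nu>0_def by (simp add: orbit_functional_linear sum_distrib_left mult_ac)
  have nuB: "\<nu> b = 0" if "b \<in> B" for b
    using \<alpha>(2)[OF that] by (simp add: \<nu>_def \<beta>_def flip: sum_divide_distrib)
  have small: "norm (\<nu> (pencil T m f)) \<le> card Y * \<epsilon> * norm f" for f
  proof -
    have "norm (\<nu> (pencil T m f)) \<le> (\<Sum>y\<in>Y. \<epsilon> * norm f)"
      unfolding \<nu>_def
    proof (rule order_trans[OF norm_sum sum_mono])
      fix y assume y: "y \<in> Y"
      have "norm (\<beta> y * \<nu>0 y (pencil T m f)) \<le> 1 * (\<epsilon> * norm f)"
        unfolding norm_mult
      proof (rule mult_mono[OF \<beta>(2)[OF y]])
        show "norm (\<nu>0 y (pencil T m f)) \<le> \<epsilon> * norm f"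
          unfolding \<nu>0_def using n[OF y]
          by (intro order_trans[OF orbit_functional_pencil[OF Yb(1)[OF y] m(4)]] mult_right_mono) auto
      qed auto
      then show "norm (\<beta> y * \<nu>0 y (pencil T m f)) \<le> \<epsilon> * norm f" by simp
    qed
    then show ?thesis by simp
  qed
  define K where "K = onorm \<nu>"
  have K: "norm (\<nu> f) \<le> K * norm f" for f unfolding K_def by (rule onorm[OF bl])
  have K0: "K \<ge> 0" unfolding K_def by (rule onorm_pos_le[OF bl])
  have "norm (\<nu> (pencil T l f)) \<le> (card Y * \<epsilon> + norm (l - m) * K) * norm f" for f
  proof -
    interpret bounded_linear \<nu> by (rule bl)
    have "pencil T l f = pencil T m f + (l - m) *\<^sub>C f"
      by (simp add: pencil_def cvec.scale_left_diff_distrib)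
    then have "\<nu> (pencil T l f) = \<nu> (pencil T m f) + (l - m) * \<nu> f" by (simp add: add lin)
    also have "norm \<dots> \<le> card Y * \<epsilon> * norm f + norm (l - m) * (K * norm f)"
      by (rule order_trans[OF norm_triangle_ineq]) (intro add_mono small, simp add: norm_mult mult_left_mono K)
    finally show ?thesis by (simp add: algebra_simps)
  qed
  then have "norm (\<nu> f) \<le> C * (card Y * \<epsilon> + norm (l - m) * K) * norm f" for f
    using \<epsilon>(1) K0 by (intro est bl lin nuB) auto
  then have "onorm \<nu> \<le> C * (card Y * \<epsilon> + norm (l - m) * K)"
    using C K0 \<epsilon>(1) by (intro onorm_bound) auto
  then have "K \<le> C * (card Y * \<epsilon> + norm (l - m) * K)" by (simp only: K_def)
  also have "\<dots> \<le> 1 / 4 + 1 / 4 * K"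
    using \<epsilon>(2) mult_right_mono[OF m(3) K0] by (simp add: algebra_simps)
  finally have K_small: "K < 1" by simp
  have "y0 \<in> sphere 0 1" using y0 Y by auto
  then obtain h where h: "ev h (x, y0) = 1" "norm h \<le> 1" "\<And>p. p \<in> bidisc \<Longrightarrow> p \<noteq> (x, y0) \<Longrightarrow> norm (ev h p) < 1"
    using peak_function[of "(x, y0)"] x by auto
  have "(\<lambda>j. \<nu> (h ^ j)) \<longlonglongrightarrow> (\<Sum>y\<in>Y. \<beta> y * (if (x, y) = (x, y0) then 1 else 0))"
    unfolding \<nu>_def \<nu>0_def
  proof (intro tendsto_sum tendsto_mult_left orbit_functional_peak[OF Yb(1) Yb(1)[OF y0(1)] m(4) h(1,3)])
    fix y k assume y: "y \<in> Y" and e: "(\<Phi> ^^ k) ((\<Phi>' ^^ n) (x, y)) = (x, y0)"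
    have xc: "x \<in> cball 0 1" using x by auto
    let ?u = "(\<phi>' ^^ n) x"
    have un: "(\<phi> ^^ n) ?u = x" using iterate_inverse(2)[OF Yb(1)[OF y], of n] by (simp add: \<Phi>_iterate \<Phi>'_iterate)
    have "(\<phi> ^^ k) ?u = x" using e by (simp add: \<Phi>_iterate \<Phi>'_iterate)
    moreover have "?u \<noteq> s1" "?u \<noteq> s2" using un x S.iterate_fixed by metis+
    ultimately have "k = n" using S.no_periodic_points[OF S.iterate_cball(2)[OF xc]] un by metis
    then show "(x, y) = (x, y0) \<and> k = n" using e iterate_inverse(2)[OF Yb(1)[OF y], of n] by simp
  qed
  moreover have "(\<Sum>y\<in>Y. \<beta> y * (if (x, y) = (x, y0) then 1 else 0)) = 1"
    using y0(1) Y(1) \<beta>(1) by (simp add: if_distrib sum.delta cong: if_cong)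
  ultimately have lim: "(\<lambda>j. norm (\<nu> (h ^ j))) \<longlonglongrightarrow> norm (1 :: complex)" by (intro tendsto_norm) simp
  have "norm (\<nu> (h ^ j)) \<le> K" for j
    using K[of "h ^ j"] mult_left_mono[OF norm_power_le_1[OF h(2)] K0, of j] by simp
  then have "norm (1 :: complex) \<le> K" using LIMSEQ_le_const2[OF lim] by blast
  then show False using K_small by simp
qed

section \<open>The spectra\<close>

definition corner_weights where
  "corner_weights = (\<lambda>P. norm (ev w P)) ` ({s1, s2} \<times> {t1, t2})"

text \<open>By the order of the weights, \<open>|l|\<close> fails to separate in the sense of \<open>bounded_below_pencil\<close> only if the forward
  and the backward weight of some orbit both equal \<open>|l|\<close>.\<close>
lemma bounded_below_pencil_iff:
  assumes order: "norm (ev w (s1, t1)) \<le> norm (ev w (s1, t2))" "norm (ev w (s1, t2)) \<le> norm (ev w (s2, t2))"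
    "norm (ev w (s1, t1)) \<le> norm (ev w (s2, t1))" "norm (ev w (s2, t1)) \<le> norm (ev w (s2, t2))"
  shows "bounded_below (pencil T l) \<longleftrightarrow> norm l \<notin> corner_weights"
proof
  show "norm l \<notin> corner_weights" if "bounded_below (pencil T l)"
    using that not_bounded_below_pencil by (auto simp: corner_weights_def)
  assume l: "norm l \<notin> corner_weights"
  show "bounded_below (pencil T l)"
  proof (rule bounded_below_pencil)
    fix p :: "complex \<times> complex"
    have "forward_weight p \<in> corner_weights"
      by (auto simp: forward_weight_def corner_weights_def S.forward_limit_def R.forward_limit_def)
    then have "forward_weight p \<noteq> norm l" using l by metis
    moreover have "forward_weight p \<le> backward_weight p"
      using order S.distinct R.distinct
      by (auto simp: forward_weight_def backward_weight_def S.forward_limit_def R.forward_limit_def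
          S.backward_limit_def R.backward_limit_def)
    ultimately show "forward_weight p < norm l \<or> norm l < backward_weight p"
      by linarith
  qed
qed

end

lemma image_scaled_circle:
  assumes "0 \<le> \<rho>"
  shows "(*) (complex_of_real \<rho>) ` sphere 0 1 = {l. norm l = \<rho>}"
proof (intro equalityI subsetI)
  fix l assume "l \<in> {l::complex. norm l = \<rho>}"
  then have l: "norm l = \<rho>" by simp
  show "l \<in> (*) (complex_of_real \<rho>) ` sphere 0 1"
  proof (cases "l = 0")
    case True
    then show ?thesis using l by (intro image_eqI[of _ _ 1]) auto
  next
    case False
    then show ?thesis using l by (intro image_eqI[of _ _ "l / of_real \<rho>"]) (auto simp: norm_divide)
  qed
qed (use assms in \<open>auto simp: norm_mult\<close>)

theorem proposition4p12:
  fixes \<phi> \<psi> :: "complex \<Rightarrow> complex"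
    and s1 s2 t1 t2 :: complex
    and w :: bidisc_algebra
    and T :: "bidisc_algebra \<Rightarrow> bidisc_algebra"
    and r R :: real
  assumes "hyperbolic_automorphism \<phi>"
    and "attracting_fixed_point \<phi> s1" and "repelling_fixed_point \<phi> s2"
    and "hyperbolic_automorphism \<psi>"
    and "attracting_fixed_point \<psi> t1" and "repelling_fixed_point \<psi> t2"
    and T: "\<forall>f. \<forall>z1\<in>cball 0 1. \<forall>z2\<in>cball 0 1. ev (T f) (z1, z2) = ev w (z1, z2) * ev f (\<phi> z1, \<psi> z2)"
    and "w dvd 1"
    and "r = norm (ev w (s1, t1))"
    and "norm (ev w (s1, t1)) < norm (ev w (s1, t2))"
    and "norm (ev w (s1, t2)) < norm (ev w (s2, t1))"
    and "norm (ev w (s2, t1)) < norm (ev w (s2, t2))"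
    and "norm (ev w (s2, t2)) = R"
  shows "lsf_spectrum T = op_spectrum T \<and> op_spectrum T = annulus r R \<and>
    usf_spectrum T =
      (*) (complex_of_real r) ` sphere 0 1 \<union>
      (*) (complex_of_real (norm (ev w (s1, t2)))) ` sphere 0 1 \<union>
      (*) (complex_of_real (norm (ev w (s2, t1)))) ` sphere 0 1 \<union>
      (*) (complex_of_real R) ` sphere 0 1"
proof -
  obtain \<phi>' where \<phi>': "north_south \<phi> \<phi>' s1 s2" using hyperbolic_north_south assms(1-3) .
  obtain \<psi>' where \<psi>': "north_south \<psi> \<psi>' t1 t2" using hyperbolic_north_south assms(4-6) .
  interpret weighted_composition \<phi> \<phi>' s1 s2 \<psi> \<psi>' t1 t2 w T
  proof (intro weighted_composition.intro weighted_composition_axioms.intro \<phi>' \<psi>')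
    show "ev (T f) p = ev w p * ev f (\<phi> (fst p), \<psi> (snd p))" if "p \<in> bidisc" for f p
      using T that by (cases p) auto
  qed (rule assms)
  note order = assms(10-12)
  have rR: "r = norm (ev w (s1, t1))" "R = norm (ev w (s2, t2))" using assms(9,13) by auto
  have corners: "corner_weights = {r, norm (ev w (s1, t2)), norm (ev w (s2, t1)), R}"
    unfolding corner_weights_def rR by auto
  have bb: "bounded_below (pencil T l) \<longleftrightarrow> norm l \<notin> corner_weights" for l
    using order by (intro bounded_below_pencil_iff) auto
  have A: "bounded_clinear (pencil T l)" for l by (rule bounded_clinear_pencil[OF bounded_clinear_T])
  have eqs: "op_spectrum T = {l. \<not> op_invertible (pencil T l)}"
    "usf_spectrum T = {l. \<not> upper_semi_fredholm (pencil T l)}"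
    "lsf_spectrum T = {l. \<not> lower_semi_fredholm (pencil T l)}"
    by (simp_all add: op_spectrum_def usf_spectrum_def lsf_spectrum_def pencil_def[abs_def])
  have "annulus r R \<subseteq> lsf_spectrum T"
    unfolding eqs annulus_def using not_lower_semi_fredholm order rR by force
  moreover have "lsf_spectrum T \<subseteq> op_spectrum T"
  proof -
    have "lower_semi_fredholm (pencil T l)" if inv: "op_invertible (pencil T l)" for l
    proof -
      obtain G where "pencil T l \<circ> G = id" using inv unfolding op_invertible_def by blast
      then have "pencil T l (G y) = y" for y by (simp add: fun_eq_iff)
      then have "range (pencil T l) = UNIV" by (intro equalityI subset_UNIV subsetI) (metis rangeI)
      then show ?thesis unfolding lower_semi_fredholm_def using A by (auto intro!: exI[of _ "{}"])
    qed
    then show ?thesis unfolding eqs by blast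
  qed
  moreover have "op_spectrum T \<subseteq> annulus r R"
  proof -
    have "op_invertible (pencil T l)" if "l \<notin> annulus r R" for l
    proof -
      have b: "bounded_below (pencil T m)" if "norm m < r \<or> R < norm m" for m
        using that order rR by (auto simp: bb corners)
      have l: "norm l < r \<or> R < norm l" using that by (auto simp: annulus_def)
      then have "surj (pencil T l)"
      proof
        show "surj (pencil T l)" if "norm l < r" by (rule surj_pencil_inside[OF b that]) simp
        show "surj (pencil T l)" if "R < norm l" by (rule surj_pencil_outside[OF b that]) simp
      qed
      then show ?thesis by (rule op_invertible_pencil[OF bounded_clinear_T b[OF l]])
    qed
    then show ?thesis unfolding eqs by blast
  qed
  moreover have "usf_spectrum T = {l. norm l \<in> corner_weights}"
  proof -
    have "upper_semi_fredholm (pencil T l) \<longleftrightarrow> bounded_below (pencil T l)" for l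
    proof -
      have ker: "x = 0" if "pencil T l x = 0" for x
        by (rule kernel_trivial[OF _ that]) (use order in linarith)
      have bl: "bounded_linear (pencil T l)" by (rule bounded_clinearD[OF A])
      have "upper_semi_fredholm (pencil T l) \<longleftrightarrow> closed (range (pencil T l))"
        unfolding upper_semi_fredholm_def using A ker by (auto intro!: exI[of _ "{}"])
      also have "\<dots> \<longleftrightarrow> bounded_below (pencil T l)"
        using bounded_below_if_closed_range[OF bl _ ker] closed_range_if_bounded_below[OF bl] by blast
      finally show ?thesis .
    qed
    then show ?thesis unfolding eqs bb by blast
  qed
  moreover have "{l. norm l \<in> corner_weights} =
      (*) (complex_of_real r) ` sphere 0 1 \<union>
      (*) (complex_of_real (norm (ev w (s1, t2)))) ` sphere 0 1 \<union>
      (*) (complex_of_real (norm (ev w (s2, t1)))) ` sphere 0 1 \<union>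
      (*) (complex_of_real R) ` sphere 0 1"
    by (auto simp: corners image_scaled_circle rR)
  ultimately show ?thesis by blast
qed

end
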